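(* Let $G$ be an infinite compact abelian group with dual group $\Gamma$. Let $\varphi:[0,\infty)\to\mathbb R$ be an essentially concave, unbounded function, let $\Omega:\ell_2^0(\Gamma)\to\ell_2^0(\Gamma)$ be the Kalton–Peck map associated to $\varphi$, and for $1\le q\le 2\le p\le\infty$ let $\mho^{pq}:L_p^0(G)\to L_q(G)$ be the map $\mho^{pq}(f)=\mathscr F^{-1}(\Omega(\widehat f))$. Then $\mho^{\infty 1}:C^0(G)\to L_1(G)$ is not trivial, and neither is $\mho^{pq}:L_p^0(G)\to L_q(G)$ for any $1\le q\le 2\le p\le\infty$.
   Context: $G$ carries its normalized Haar measure; function spaces are complex. $\mathscr F(f)=\widehat f$ denotes the Fourier transform, $\widehat f(\gamma)=\int_G f(x)\overline{\gamma}(x)\,dx$, an isometry of $L_2(G)$ onto $\ell_2(\Gamma)$ with inverse $\mathscr F^{-1}$. $P(G)$ is the space of polynomials (finite linear combinations of characters). $L_p^0(G)$ denotes $P(G)$ with the norm of $L_p(G)$, and $C^0(G)=L_\infty^0(G)$ is $P(G)$ with the sup norm. $\ell_2^0(\Gamma)$ is the subspace of finitely supported elements of $\ell_2(\Gamma)$. A Lipschitz function $\varphi:[0,\infty)\to\mathbb R$ with $\varphi(0)=0$ is *essentially concave* if it is non-negative and concave on some interval $[t,\infty)$. The *Kalton–Peck map* associated to $\varphi$ is defined pointwise by $\Omega(c)=c\,\varphi\big(\log\frac{\|c\|_2}{|c|}\big)$ (with value $0$ where $c$ vanishes). A homogeneous map $\Phi:X\to Y$ between quasinormed spaces is *quasilinear*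 if $\|\Phi(x+x')-\Phi(x)-\Phi(x')\|\le Q(\|x\|+\|x'\|)$ for some $Q$ and all $x,x'$. All maps $\mho^{pq}$ are quasilinear. A quasilinear map $\Phi:X\to Y$ is *trivial* if there are a (not necessarily continuous) linear map $L:X\to Y$ and a constant $K$ with $\|\Phi(x)-L(x)\|\le K\|x\|$ for all $x\in X$. *)

theory Defs
  imports "HOL-Analysis.Analysis" "HOL-Probability.Essential_Supremum"
begin

text \<open>
  The group \<open>G\<close> is a type of class \<open>topological_ab_group_add\<close>, written additively.
  Elements of \<open>L\<^sub>p(G)\<close> are represented by functions, and identities between them are
  stated almost everywhere.
\<close>

definition normalized_haar :: "'a::topological_ab_group_add measure \<Rightarrow> bool" where
  "normalized_haar M \<longleftrightarrow>
     sets M = sets borel \<and>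
     emeasure M UNIV = 1 \<and>
     (\<forall>a. distr M borel (\<lambda>x. a + x) = M) \<and>
     (\<forall>A\<in>sets borel. emeasure M A = (SUP C\<in>{C. compact C \<and> C \<subseteq> A}. emeasure M C)) \<and>
     (\<forall>A\<in>sets borel. emeasure M A = (INF U\<in>{U. open U \<and> A \<subseteq> U}. emeasure M U))"

typedef (overloaded) 'a dual =
  "{\<gamma> :: 'a::topological_ab_group_add \<Rightarrow> complex.
      continuous_on UNIV \<gamma> \<and> (\<forall>x. cmod (\<gamma> x) = 1) \<and> (\<forall>x y. \<gamma> (x + y) = \<gamma> x * \<gamma> y)}"
  morphisms char_fun Abs_dual
  by (rule exI[of _ "\<lambda>_. 1"]) simp

definition Lp_space :: "'a measure \<Rightarrow> ereal \<Rightarrow> ('a \<Rightarrow> complex) set" where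
  "Lp_space M p = {f \<in> borel_measurable M.
     if p = \<infinity> then esssup M (\<lambda>x. ereal (cmod (f x))) < \<infinity>
     else integrable M (\<lambda>x. cmod (f x) powr real_of_ereal p)}"

definition Lp_norm :: "'a measure \<Rightarrow> ereal \<Rightarrow> ('a \<Rightarrow> complex) \<Rightarrow> real" where
  "Lp_norm M p f =
     (if p = \<infinity> then real_of_ereal (esssup M (\<lambda>x. ereal (cmod (f x))))
      else (LINT x|M. cmod (f x) powr real_of_ereal p) powr (1 / real_of_ereal p))"

definition sup_norm :: "('a \<Rightarrow> complex) \<Rightarrow> real" where
  "sup_norm f = (SUP x. cmod (f x))"

definition polynomials :: "('a::topological_ab_group_add \<Rightarrow> complex) set" where
  "polynomials = {f. \<exists>S a. finite S \<and> f = (\<lambda>x. \<Sum>\<gamma>\<in>S. a \<gamma> * char_fun \<gamma> x)}"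

definition fourier ::
  "'a::topological_ab_group_add measure \<Rightarrow> ('a \<Rightarrow> complex) \<Rightarrow> 'a dual \<Rightarrow> complex" where
  "fourier M f \<gamma> = (LINT x|M. f x * cnj (char_fun \<gamma> x))"

text \<open>
  The Fourier transform is injective on \<open>L\<^sub>2(G)\<close> up to null functions, so \<open>inv_into\<close>
  picks some representative of the class of the inverse transform.
\<close>

definition fourier_inv ::
  "'a::topological_ab_group_add measure \<Rightarrow> ('a dual \<Rightarrow> complex) \<Rightarrow> 'a \<Rightarrow> complex" where
  "fourier_inv M = inv_into (Lp_space M 2) (fourier M)"

definition essentially_concave :: "(real \<Rightarrow> real) \<Rightarrow> bool" where
  "essentially_concave \<phi> \<longleftrightarrow>
     (\<exists>C. C-lipschitz_on {0..} \<phi>) \<and> \<phi> 0 = 0 \<and>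
     (\<exists>t\<ge>0. (\<forall>s\<ge>t. 0 \<le> \<phi> s) \<and> concave_on {t..} \<phi>)"

definition l2_norm :: "('i \<Rightarrow> complex) \<Rightarrow> real" where
  "l2_norm c = sqrt (\<Sum>\<^sub>\<infinity>i. (cmod (c i))\<^sup>2)"

definition kalton_peck :: "(real \<Rightarrow> real) \<Rightarrow> ('i \<Rightarrow> complex) \<Rightarrow> 'i \<Rightarrow> complex" where
  "kalton_peck \<phi> c i =
     (if c i = 0 then 0 else c i * complex_of_real (\<phi> (ln (l2_norm c / cmod (c i)))))"

definition mho ::
  "'a::topological_ab_group_add measure \<Rightarrow> (real \<Rightarrow> real) \<Rightarrow> ('a \<Rightarrow> complex) \<Rightarrow> 'a \<Rightarrow> complex" where
  "mho M \<phi> f = fourier_inv M (kalton_peck \<phi> (fourier M f))"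

text \<open>
  Triviality of a map \<open>\<Phi>\<close> from the function space \<open>X\<close>, normed by \<open>N\<close>, to \<open>L\<^sub>q(M)\<close>.
  Choosing representatives, a linear map into the quotient \<open>L\<^sub>q(M)\<close> is the same as a map
  into functions that is linear up to null sets.
\<close>

definition trivial_into_Lq ::
  "('a \<Rightarrow> complex) set \<Rightarrow> (('a \<Rightarrow> complex) \<Rightarrow> real) \<Rightarrow> 'a measure \<Rightarrow> ereal \<Rightarrow>
   (('a \<Rightarrow> complex) \<Rightarrow> 'a \<Rightarrow> complex) \<Rightarrow> bool" where
  "trivial_into_Lq X N M q \<Phi> \<longleftrightarrow>
     (\<exists>L :: ('a \<Rightarrow> complex) \<Rightarrow> 'a \<Rightarrow> complex.
        (\<forall>f\<in>X. L f \<in> Lp_space M q) \<and>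
        (\<forall>f\<in>X. \<forall>g\<in>X. AE x in M. L (\<lambda>y. f y + g y) x = L f x + L g x) \<and>
        (\<forall>c. \<forall>f\<in>X. AE x in M. L (\<lambda>y. c * f y) x = c * L f x) \<and>
        (\<exists>K. \<forall>f\<in>X. Lp_norm M q (\<lambda>x. \<Phi> f x - L f x) \<le> K * N f))"

end

theory Submission
  imports Defs "HOL-Probability.Probability"
begin

text \<open>
  Suppose \<open>L\<close> is linear and at bounded distance from \<open>\<mho>\<close>. Since \<open>\<mho>\<close> commutes with translations,
  averaging over \<open>G\<close> replaces \<open>L\<close> by the Fourier multiplier whose symbol \<open>A \<gamma>\<close> is the Fourier
  coefficient of \<open>L \<gamma>\<close> at \<open>\<gamma>\<close>. Testing against single characters, on which \<open>\<mho>\<close> vanishes,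
  shows that \<open>A\<close> is bounded. Testing against the Rudin--Shapiro polynomials \<open>f\<close> with \<open>2\<^sup>k\<close> unimodular coefficients and \<open>\<bar>f\<bar>\<^sup>2 \<le> 2\<^bsup>k+1\<^esup>\<close>, and pairing
  \<open>\<mho> f\<close> with \<open>f\<close> itself, then shows that \<open>\<phi> (k ln 2 / 2)\<close> is bounded in \<open>k\<close>, so the Lipschitz
  function \<open>\<phi>\<close> would be bounded.

  The polynomials exist because the dual group is infinite, which needs enough characters. For a
  continuous \<open>f \<noteq> 0\<close> the normalised convolution powers of \<open>f * f\<^sup>*\<close> converge uniformly to a
  self-adjoint convolution idempotent; a minimal idempotent below it spans a one-dimensional
  translation-invariant space, hence is a multiple of a character, and \<open>f\<close> has a non-zero Fourier
  coefficient there.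
\<close>

section \<open>Haar measure and uniform continuity\<close>

locale compact_haar_group =
  fixes M :: "'a::{topological_ab_group_add, t2_space} measure"
  assumes compact_UNIV: "compact (UNIV :: 'a set)"
    and haar: "normalized_haar M"
begin

lemma sets_M [measurable_cong]: "sets M = sets borel"
  using haar by (simp add: normalized_haar_def)

lemma space_M [simp]: "space M = UNIV"
  using sets_eq_imp_space_eq[OF sets_M] by simp

sublocale prob_space M
  using haar by (intro prob_spaceI) (simp add: normalized_haar_def)

lemma continuous_imp_measurable:
  fixes f :: "'a \<Rightarrow> 'b::topological_space"
  assumes "continuous_on UNIV f"
  shows "f \<in> borel_measurable M"
  using borel_measurable_continuous_onI[OF assms] measurable_cong_sets[OF sets_M refl] by blast

lemma continuous_imp_bounded:
  fixes f :: "'a \<Rightarrow> complex"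
  assumes "continuous_on UNIV f"
  obtains B where "B \<ge> 0" "\<And>x. cmod (f x) \<le> B"
proof -
  have "bounded (range f)"
    using compact_continuous_image[OF assms compact_UNIV] compact_imp_bounded by blast
  then obtain B where "\<And>x. cmod (f x) \<le> B"
    by (auto simp: bounded_iff)
  moreover from this[of 0] have "B \<ge> 0"
    using norm_ge_zero order_trans by blast
  ultimately show thesis by (rule that[rotated])
qed

lemma continuous_imp_integrable:
  fixes f :: "'a \<Rightarrow> complex"
  assumes "continuous_on UNIV f"
  shows "integrable M f"
proof -
  obtain B where "\<And>x. cmod (f x) \<le> B"
    using continuous_imp_bounded[OF assms] by metis
  then show ?thesis
    by (intro integrable_const_bound[of _ B] continuous_imp_measurable assms) auto
qed

lemma continuous_imp_integrable_norm:
  fixes f :: "'a \<Rightarrow> complex"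
  assumes "continuous_on UNIV f"
  shows "integrable M (\<lambda>x. cmod (f x) ^ n)"
proof -
  have "integrable M (\<lambda>x. complex_of_real (cmod (f x) ^ n))"
    by (intro continuous_imp_integrable continuous_intros assms)
  from integrable_Re[OF this] show ?thesis by simp
qed

lemma continuous_translate:
  fixes f :: "'a \<Rightarrow> 'b::topological_space"
  assumes "continuous_on UNIV f"
  shows "continuous_on UNIV (\<lambda>y. f (x + y))" "continuous_on UNIV (\<lambda>y. f (y + x))"
    "continuous_on UNIV (\<lambda>y. f (y - x))"
    "continuous_on UNIV (\<lambda>y. f (x - y))" "continuous_on UNIV (\<lambda>y. f (- y))"
  by (rule continuous_on_compose2[OF assms], (intro continuous_intros), simp)+

lemma integral_translate:
  fixes f :: "'a \<Rightarrow> 'b::{banach, second_countable_topology}"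
  assumes "f \<in> borel_measurable M"
  shows "(LINT x|M. f (a + x)) = (LINT x|M. f x)"
proof -
  have f: "f \<in> borel_measurable borel"
    using assms measurable_cong_sets[OF sets_M refl] by blast
  have "(LINT x|M. f x) = (LINT x|distr M borel (\<lambda>x. a + x). f x)"
    using haar by (simp add: normalized_haar_def)
  also have "\<dots> = (LINT x|M. f (a + x))"
    by (intro integral_distr f continuous_imp_measurable continuous_intros)
  finally show ?thesis by simp
qed

text \<open>The pairs \<open>(z, u)\<close> with \<open>f (z - u)\<close> close to
  \<open>f z\<close> form an open set around \<open>UNIV \<times> {0}\<close>. As the first factor
  is compact, the tube lemma yields one neighbourhood \<open>U\<close> that serves all
  \<open>z\<close>.\<close>

lemma uniformly_continuous:
  fixes f :: "'a \<Rightarrow> complex"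
  assumes f: "continuous_on UNIV f" and e: "e > 0"
  obtains U where "open U" "0 \<in> U" "\<And>z u. u \<in> U \<Longrightarrow> cmod (f (z - u) - f z) < e"
proof -
  let ?W = "{p :: 'a \<times> 'a. cmod (f (fst p - snd p) - f (fst p)) < e}"
  have c1: "continuous_on UNIV (\<lambda>p :: 'a \<times> 'a. f (fst p - snd p))"
    by (rule continuous_on_compose2[OF f]) (auto intro!: continuous_intros)
  have c2: "continuous_on UNIV (\<lambda>p :: 'a \<times> 'a. f (fst p))"
    by (rule continuous_on_compose2[OF f]) (auto intro!: continuous_intros)
  have "open ?W"
    by (intro open_Collect_less continuous_intros c1 c2)
  then have "openin (prod_topology euclidean euclidean) ?W"
    by simp
  moreover have "(UNIV :: 'a set) \<times> {0} \<subseteq> ?W"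
    using e by auto
  moreover have "compactin euclidean (UNIV :: 'a set)"
    using compact_UNIV by simp
  ultimately obtain V U where "openin euclidean U" "(UNIV :: 'a set) \<subseteq> V" "0 \<in> U" "V \<times> U \<subseteq> ?W"
    using tube_lemma_left[of euclidean euclidean ?W UNIV 0] by auto
  then show thesis
    by (intro that[of U]) (auto simp: subset_iff)
qed

text \<open>No countability of the topology is available, so Borel sets of the square need not be
  product measurable; continuous functions of the difference are nevertheless uniform limits of
  functions that depend on the second variable through a measurable function with values in
  \<open>\<nat>\<close>.\<close>

lemma measurable_diff:
  fixes f :: "'a \<Rightarrow> complex"
  assumes f: "continuous_on UNIV f"
  shows "(\<lambda>p. f (fst p - snd p)) \<in> borel_measurable (M \<Otimes>\<^sub>M M)"
proof -
  have "\<exists>g. g \<in> borel_measurable (M \<Otimes>\<^sub>M M) \<and> (\<forall>p. cmod (f (fst p - snd p) - g p) < e)"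
    if e: "e > 0" for e
  proof -
    obtain U where U: "open U" "0 \<in> U" "\<And>z u. u \<in> U \<Longrightarrow> cmod (f (z - u) - f z) < e"
      using uniformly_continuous[OF f e] by metis
    have op: "open {y. y - a \<in> U}" for a
    proof -
      have "open ((\<lambda>y. y - a) -` U)"
        by (intro open_vimage U continuous_intros)
      then show ?thesis by (simp add: vimage_def)
    qed
    obtain A where A: "finite A" "UNIV \<subseteq> (\<Union>a\<in>A. {y. y - a \<in> U})"
    proof (rule compactE_image[OF compact_UNIV, of UNIV "\<lambda>a. {y. y - a \<in> U}"])
      show "UNIV \<subseteq> (\<Union>a. {y. y - a \<in> U})"
      proof
        fix y :: 'a
        have "y - y \<in> U" using U(2) by simp
        then show "y \<in> (\<Union>a. {y. y - a \<in> U})" by blast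
      qed
    qed (use op in auto)
    obtain s where s: "set s = A" using finite_list[OF A(1)] by blast
    \<comment> \<open>The first translate of \<open>U\<close> in the finite list that contains
      \<open>y\<close>. Minimising over all naturals makes \<open>n\<close> measurable; the cover
      keeps the index in range.\<close>
    define n where "n y = (LEAST i. y - s ! i \<in> U)" for y
    have nU: "y - s ! n y \<in> U" for y
    proof -
      obtain a where "a \<in> A" "y - a \<in> U" using A(2) by auto
      then obtain i where "y - s ! i \<in> U" using s by (metis in_set_conv_nth)
      then show ?thesis unfolding n_def by (rule LeastI)
    qed
    have pr: "Measurable.pred M (\<lambda>y. y - s ! i \<in> U)" for i
    proof -
      have "{y. y - s ! i \<in> U} \<in> sets M" using op by (simp add: sets_M)
      then show ?thesis by (simp add: pred_def)
    qed
    have n: "n \<in> measurable M (count_space UNIV)"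
      unfolding n_def by (rule measurable_Least) (rule pr)
    have "(\<lambda>p. f (fst p - s ! n (snd p))) \<in> borel_measurable (M \<Otimes>\<^sub>M M)"
    proof (rule measurable_compose_countable)
      show "(\<lambda>p. f (fst p - s ! i)) \<in> borel_measurable (M \<Otimes>\<^sub>M M)" for i
        by (rule measurable_compose[OF measurable_fst])
          (intro continuous_imp_measurable continuous_translate f)
    qed (rule measurable_compose[OF measurable_snd n])
    moreover have "cmod (f (fst p - snd p) - f (fst p - s ! n (snd p))) < e" for p :: "'a \<times> 'a"
      using U(3)[OF nU[of "snd p"], of "fst p - s ! n (snd p)"] by (simp add: algebra_simps)
    ultimately show ?thesis by blast
  qed
  then have "\<exists>g. g \<in> borel_measurable (M \<Otimes>\<^sub>M M) \<and>
      (\<forall>p. cmod (f (fst p - snd p) - g p) < inverse (real (Suc k)))" for k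
    by simp
  then obtain g where g: "\<And>k. g k \<in> borel_measurable (M \<Otimes>\<^sub>M M)"
    "\<And>k p. cmod (f (fst p - snd p) - g k p) < inverse (real (Suc k))"
    by metis
  show ?thesis
  proof (rule borel_measurable_LIMSEQ_metric[OF g(1)])
    fix p :: "'a \<times> 'a"
    have "(\<lambda>k. f (fst p - snd p) - g k p) \<longlonglongrightarrow> 0"
      by (rule Lim_null_comparison[OF _ LIMSEQ_inverse_real_of_nat],
          rule always_eventually, rule allI, rule less_imp_le, rule g(2))
    then have "(\<lambda>k. f (fst p - snd p) - (f (fst p - snd p) - g k p)) \<longlonglongrightarrow> f (fst p - snd p) - 0"
      by (intro tendsto_intros)
    then show "(\<lambda>k. g k p) \<longlonglongrightarrow> f (fst p - snd p)" by simp
  qed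
qed

lemma pair_sigma_finite_M: "pair_sigma_finite M M"
  by (simp add: pair_sigma_finite.intro sigma_finite_measure_axioms)

lemma Fubini_bounded:
  fixes F :: "'a \<Rightarrow> 'a \<Rightarrow> complex"
  assumes F: "(\<lambda>p. F (fst p) (snd p)) \<in> borel_measurable (M \<Otimes>\<^sub>M M)"
    and B: "\<And>x y. cmod (F x y) \<le> B"
  shows "(LINT y|M. LINT x|M. F x y) = (LINT x|M. LINT y|M. F x y)"
proof (rule pair_sigma_finite.Fubini_integral[OF pair_sigma_finite_M])
  interpret P: pair_prob_space M M
    by (simp add: pair_prob_space_def pair_sigma_finite_M prob_space_axioms)
  show "integrable (M \<Otimes>\<^sub>M M) (case_prod F)"
    by (rule P.P.integrable_const_bound[of _ B]) (use F B in \<open>auto simp: case_prod_beta'\<close>)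
qed

text \<open>Inversion invariance follows from translation invariance: integrating
  \<open>f (x - y)\<close> over \<open>x\<close> first gives the integral of \<open>f\<close>, over
  \<open>y\<close> first that of \<open>f (- x)\<close>.\<close>

lemma integral_uminus:
  fixes f :: "'a \<Rightarrow> complex"
  assumes f: "continuous_on UNIV f"
  shows "(LINT x|M. f (- x)) = (LINT x|M. f x)"
proof -
  obtain B where B: "\<And>x. cmod (f x) \<le> B"
    using continuous_imp_bounded[OF f] by metis
  have 1: "(LINT x|M. f (x - y)) = (LINT x|M. f x)" for y
    using integral_translate[OF continuous_imp_measurable[OF f], of "- y"] by simp
  have 2: "(LINT y|M. f (x - y)) = (LINT x|M. f (- x))" for x
    using integral_translate[OF continuous_imp_measurable[OF continuous_translate(5)[OF f]], of "- x"]
    by simp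
  have "(LINT y|M. LINT x|M. f (x - y)) = (LINT x|M. LINT y|M. f (x - y))"
    by (rule Fubini_bounded[of "\<lambda>x y. f (x - y)", OF measurable_diff[OF f] B])
  then show ?thesis using prob_space by (simp add: 1 2)
qed

end

section \<open>Convolution\<close>

context compact_haar_group
begin

lemma integral_reflect:
  fixes f :: "'a \<Rightarrow> complex"
  assumes f: "continuous_on UNIV f"
  shows "(LINT y|M. f (x - y)) = (LINT y|M. f y)"
  using integral_translate[OF continuous_imp_measurable[OF continuous_translate(5)[OF f]], of "- x"]
  by (simp add: integral_uminus[OF f])

lemma norm_integral_le:
  fixes f :: "'a \<Rightarrow> complex"
  assumes "continuous_on UNIV f" "\<And>x. cmod (f x) \<le> B"
  shows "cmod (LINT x|M. f x) \<le> B"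
proof -
  have "cmod (LINT x|M. f x) \<le> (LINT x|M. cmod (f x))"
    by (rule integral_norm_bound)
  also have "\<dots> \<le> (LINT x|M. B)"
    using continuous_imp_integrable_norm[OF assms(1), of 1] assms(2) by (intro integral_mono) auto
  finally show ?thesis using prob_space by simp
qed

text \<open>By compactness finitely many translates of \<open>{y. f y \<noteq> 0}\<close> cover the
  group, so the corresponding sum of translates of the squared modulus is positive everywhere. Its
  integral is \<open>card A\<close> times the one in question.\<close>

lemma integral_norm_square_pos:
  fixes f :: "'a \<Rightarrow> complex"
  assumes f: "continuous_on UNIV f" and x: "f x \<noteq> 0"
  shows "0 < (LINT x|M. (cmod (f x))\<^sup>2)"
proof -
  have op: "open {y. f (a + y) \<noteq> 0}" for a
    by (intro open_Collect_neq continuous_translate[OF f] continuous_intros)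
  obtain A where A: "finite A" "UNIV \<subseteq> (\<Union>a\<in>A. {y. f (a + y) \<noteq> 0})"
  proof (rule compactE_image[OF compact_UNIV, of UNIV "\<lambda>a. {y. f (a + y) \<noteq> 0}"])
    show "UNIV \<subseteq> (\<Union>a. {y. f (a + y) \<noteq> 0})"
    proof
      fix y
      have "f ((x - y) + y) \<noteq> 0" using x by simp
      then show "y \<in> (\<Union>a. {y. f (a + y) \<noteq> 0})" by blast
    qed
  qed (use op in auto)
  let ?F = "\<lambda>y. \<Sum>a\<in>A. (cmod (f (a + y)))\<^sup>2"
  have int: "integrable M (\<lambda>y. (cmod (f (a + y)))\<^sup>2)" for a
    by (intro continuous_imp_integrable_norm continuous_translate[OF f])
  have F_pos: "?F y > 0" for y
  proof -
    obtain a where "a \<in> A" "f (a + y) \<noteq> 0" using A(2) by blast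
    then show ?thesis using A(1) by (intro sum_pos2[of A a]) auto
  qed
  have F: "(LINT y|M. ?F y) = card A * (LINT x|M. (cmod (f x))\<^sup>2)"
  proof -
    have "(LINT y|M. (cmod (f (a + y)))\<^sup>2) = (LINT x|M. (cmod (f x))\<^sup>2)" for a
      by (rule integral_translate)
        (intro borel_measurable_power continuous_imp_measurable continuous_on_norm f)
    then show ?thesis by (simp add: Bochner_Integration.integral_sum[OF int])
  qed
  have "(LINT y|M. ?F y) \<noteq> 0"
  proof
    assume "(LINT y|M. ?F y) = 0"
    then have "AE y in M. ?F y = 0"
      by (subst (asm) integral_nonneg_eq_0_iff_AE)
        (auto intro!: sum_nonneg Bochner_Integration.integrable_sum int)
    then have "AE y in M. False"
      using F_pos by (auto elim!: eventually_mono simp: less_le)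
    then show False using AE_E_prob prob_space by fastforce
  qed
  moreover have "0 \<le> (LINT x|M. (cmod (f x))\<^sup>2)" by simp
  ultimately show ?thesis using F by (metis less_le mult_zero_right)
qed

section \<open>The L2 norm and the Cauchy--Schwarz inequality\<close>

definition L2_square :: "('a \<Rightarrow> complex) \<Rightarrow> real" where
  "L2_square f = (LINT x|M. (cmod (f x))\<^sup>2)"

lemma L2_square_nonneg [simp]: "0 \<le> L2_square f"
  by (simp add: L2_square_def)

lemma L2_Cauchy_Schwarz:
  fixes f g :: "'a \<Rightarrow> complex"
  assumes f: "continuous_on UNIV f" and g: "continuous_on UNIV g"
  shows "(LINT x|M. cmod (f x) * cmod (g x))\<^sup>2 \<le> L2_square f * L2_square g"
proof -
  define A B I where "A = L2_square f" and "B = L2_square g"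
    and "I = (LINT x|M. cmod (f x) * cmod (g x))"
  have AB: "A \<ge> 0" "B \<ge> 0" by (simp_all add: A_def B_def)
  have I: "I \<ge> 0" unfolding I_def by (rule Bochner_Integration.integral_nonneg) simp
  have i1: "integrable M (\<lambda>x. (cmod (f x))\<^sup>2)" "integrable M (\<lambda>x. (cmod (g x))\<^sup>2)"
    by (intro continuous_imp_integrable_norm f g)+
  have i2: "integrable M (\<lambda>x. cmod (f x) * cmod (g x))"
    using continuous_imp_integrable_norm[of "\<lambda>x. f x * g x" 1]
    by (simp add: norm_mult continuous_intros f g)
  have quad: "0 \<le> t\<^sup>2 * A - 2 * t * I + B" for t :: real
  proof -
    have "0 \<le> (LINT x|M. (t * cmod (f x) - cmod (g x))\<^sup>2)" by simp
    also have "\<dots> = (LINT x|M. t\<^sup>2 * (cmod (f x))\<^sup>2 - 2 * t * (cmod (f x) * cmod (g x)) + (cmod (g x))\<^sup>2)"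
      by (rule Bochner_Integration.integral_cong) (auto simp: power2_eq_square algebra_simps)
    also have "\<dots> = t\<^sup>2 * A - 2 * t * I + B"
      unfolding A_def B_def I_def L2_square_def using i1 i2 by simp
    finally show ?thesis .
  qed
  show ?thesis
  proof (cases "A = 0")
    case True
    have "I = 0"
    proof (rule ccontr)
      assume "I \<noteq> 0"
      \<comment> \<open>For \<open>A = 0\<close> the quadratic is linear in \<open>t\<close>, and
        this \<open>t\<close> gives it the value -1.\<close>
      then show False using quad[of "(B + 1) / (2 * I)"] True by simp
    qed
    then show ?thesis using True by (simp add: A_def I_def)
  next
    case False
    then have "A > 0" using AB by simp
    have "0 \<le> (I / A)\<^sup>2 * A - 2 * (I / A) * I + B" by (rule quad)
    also have "\<dots> = B - I\<^sup>2 / A" using False by (simp add: field_simps power2_eq_square)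
    finally have "I\<^sup>2 \<le> A * B" using \<open>A > 0\<close> by (simp add: field_simps)
    then show ?thesis by (simp add: A_def B_def I_def)
  qed
qed

section \<open>The convolution algebra of continuous functions\<close>

definition conv :: "('a \<Rightarrow> complex) \<Rightarrow> ('a \<Rightarrow> complex) \<Rightarrow> 'a \<Rightarrow> complex" where
  "conv f g x = (LINT y|M. f (x - y) * g y)"

text \<open>The involution of the convolution algebra: convolution by \<open>star f\<close> is the
  L2 adjoint of convolution by \<open>f\<close>, so functions with \<open>star h = h\<close> act as
  self-adjoint operators.\<close>

definition star :: "('a \<Rightarrow> complex) \<Rightarrow> 'a \<Rightarrow> complex" where
  "star f x = cnj (f (- x))"

lemma continuous_conv_integrand:
  fixes f g :: "'a \<Rightarrow> complex"
  assumes "continuous_on UNIV f" "continuous_on UNIV g"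
  shows "continuous_on UNIV (\<lambda>y. f (x - y) * g y)"
  by (intro continuous_intros continuous_translate[OF assms(1)] assms(2))

lemma continuous_star:
  assumes "continuous_on UNIV f"
  shows "continuous_on UNIV (star f)"
  unfolding star_def by (intro continuous_intros continuous_translate[OF assms])

lemma star_star [simp]: "star (star f) = f"
  by (simp add: star_def fun_eq_iff)

text \<open>Uniform continuity of \<open>f\<close> makes the integrands for \<open>x\<close> and
  \<open>x'\<close> close for all \<open>y\<close> at once; boundedness of \<open>g\<close> does the
  rest.\<close>

lemma continuous_conv:
  assumes f: "continuous_on UNIV f" and g: "continuous_on UNIV g"
  shows "continuous_on UNIV (conv f g)"
proof -
  obtain B where B: "B \<ge> 0" "\<And>x. cmod (g x) \<le> B"
    using continuous_imp_bounded[OF g] by metis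
  have "(conv f g \<longlongrightarrow> conv f g x) (at x)" for x
  proof (rule tendstoI)
    fix e :: real assume e: "e > 0"
    define d where "d = e / (B + 1)"
    have d: "d > 0" "d * B < e"
      using e B(1) by (simp_all add: d_def field_simps)
    obtain U where U: "open U" "0 \<in> U" "\<And>z u. u \<in> U \<Longrightarrow> cmod (f (z - u) - f z) < d"
      using uniformly_continuous[OF f d(1)] by metis
    have "dist (conv f g x') (conv f g x) < e" if x': "x - x' \<in> U" for x'
    proof -
      have "conv f g x' - conv f g x = (LINT y|M. f (x' - y) * g y - f (x - y) * g y)"
        unfolding conv_def
        by (rule Bochner_Integration.integral_diff[symmetric])
          (intro continuous_imp_integrable continuous_conv_integrand f g)+
      also have "cmod \<dots> \<le> d * B"
      proof (rule norm_integral_le)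
        fix y
        have "cmod (f (x' - y) - f (x - y)) < d"
          using U(3)[OF x', of "x - y"] by (simp add: algebra_simps)
        then have "cmod (f (x' - y) - f (x - y)) * cmod (g y) \<le> d * B"
          using B d(1) by (intro mult_mono) auto
        then show "cmod (f (x' - y) * g y - f (x - y) * g y) \<le> d * B"
          by (simp add: left_diff_distrib[symmetric] norm_mult)
      qed (intro continuous_intros continuous_translate[OF f] continuous_translate[OF g] f g)
      finally show ?thesis using d(2) by (simp add: dist_norm)
    qed
    moreover have "open {x'. x - x' \<in> U}"
      using open_vimage[OF U(1), of "\<lambda>x'. x - x'"] by (simp add: vimage_def continuous_intros)
    moreover have "x \<in> {x'. x - x' \<in> U}" using U(2) by simp
    ultimately show "\<forall>\<^sub>F x' in at x. dist (conv f g x') (conv f g x) < e"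
      unfolding eventually_at_topological by blast
  qed
  then show ?thesis by (simp add: continuous_on_def)
qed

lemma conv_commute:
  assumes f: "continuous_on UNIV f" and g: "continuous_on UNIV g"
  shows "conv f g = conv g f"
proof
  fix x
  show "conv f g x = conv g f x"
    using integral_reflect[OF continuous_conv_integrand[OF f g, of x], of x]
    by (simp add: conv_def mult.commute[of "g _"])
qed

text \<open>After the translation in \<open>fg\<close> both sides are iterated integrals of the same
  function of \<open>z\<close> and \<open>y\<close>. Only the factor \<open>g (z - y)\<close>
  couples the variables, so \<open>measurable_diff\<close> gives the joint measurability that Fubini
  requires.\<close>

lemma conv_assoc:
  assumes f: "continuous_on UNIV f" and g: "continuous_on UNIV g" and h: "continuous_on UNIV h"
  shows "conv (conv f g) h = conv f (conv g h)"
proof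
  fix x
  obtain A B C where bd: "A \<ge> 0" "B \<ge> 0" "C \<ge> 0"
    "\<And>x. cmod (f x) \<le> A" "\<And>x. cmod (g x) \<le> B" "\<And>x. cmod (h x) \<le> C"
    using continuous_imp_bounded[OF f] continuous_imp_bounded[OF g] continuous_imp_bounded[OF h]
    by metis
  have fg: "conv f g (x - y) = (LINT z|M. f (x - z) * g (z - y))" for y
  proof -
    have "(LINT z|M. f (x - y - z) * g z) = (LINT z|M. f (x - y - (- y + z)) * g (- y + z))"
      by (rule integral_translate[symmetric])
        (intro continuous_imp_measurable continuous_conv_integrand f g)
    then show ?thesis by (simp add: conv_def)
  qed
  have "conv (conv f g) h x = (LINT y|M. LINT z|M. f (x - z) * g (z - y) * h y)"
    unfolding conv_def[of "conv f g"] fg by simp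
  also have "\<dots> = (LINT z|M. LINT y|M. f (x - z) * g (z - y) * h y)"
  proof (rule Fubini_bounded)
    show "(\<lambda>p. f (x - fst p) * g (fst p - snd p) * h (snd p)) \<in> borel_measurable (M \<Otimes>\<^sub>M M)"
      by (intro borel_measurable_times measurable_diff[OF g]
          measurable_compose[OF measurable_snd continuous_imp_measurable[OF h]]
          measurable_compose[OF measurable_fst continuous_imp_measurable[OF continuous_translate(4)[OF f]]])
    show "cmod (f (x - z) * g (z - y) * h y) \<le> A * B * C" for z y
      unfolding norm_mult using bd by (intro mult_mono) auto
  qed
  also have "\<dots> = conv f (conv g h) x"
    by (simp add: conv_def mult.assoc)
  finally show "conv (conv f g) h x = conv f (conv g h) x" .
qed

lemma conv_linear_left:
  assumes f: "continuous_on UNIV f" and g: "continuous_on UNIV g" and h: "continuous_on UNIV h"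
  shows "conv (\<lambda>x. a * f x + b * g x) h x = a * conv f h x + b * conv g h x"
proof -
  have "conv (\<lambda>x. a * f x + b * g x) h x
      = (LINT y|M. a * (f (x - y) * h y) + b * (g (x - y) * h y))"
    by (simp add: conv_def algebra_simps)
  also have "\<dots> = a * conv f h x + b * conv g h x"
    unfolding conv_def
    using continuous_imp_integrable[OF continuous_conv_integrand[OF f h]]
      continuous_imp_integrable[OF continuous_conv_integrand[OF g h]]
    by simp
  finally show ?thesis .
qed

lemma conv_linear_right:
  assumes f: "continuous_on UNIV f" and g: "continuous_on UNIV g" and h: "continuous_on UNIV h"
  shows "conv h (\<lambda>x. a * f x + b * g x) x = a * conv h f x + b * conv h g x"
proof -
  have "continuous_on UNIV (\<lambda>x. a * f x + b * g x)"
    by (intro continuous_intros f g)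
  then show ?thesis
    using conv_linear_left[OF f g h, of a b x] conv_commute[OF _ h] f g by simp
qed

lemma conv_scale:
  "conv (\<lambda>x. c * f x) g x = c * conv f g x" "conv f (\<lambda>x. c * g x) x = c * conv f g x"
  by (simp_all add: conv_def mult.assoc mult.left_commute)

lemma conv_zero [simp]: "conv f (\<lambda>x. 0) = (\<lambda>x. 0)" "conv (\<lambda>x. 0) f = (\<lambda>x. 0)"
  by (simp_all add: conv_def fun_eq_iff)

lemma star_conv:
  assumes f: "continuous_on UNIV f" and g: "continuous_on UNIV g"
  shows "star (conv f g) = conv (star f) (star g)"
proof
  fix x
  have "star (conv f g) x = (LINT y|M. cnj (f (- x - y) * g y))"
    by (simp add: star_def conv_def del: complex_cnj_mult)
  also have "\<dots> = (LINT y|M. cnj (f (- x - (- y)) * g (- y)))"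
    by (rule integral_uminus[symmetric]) (intro continuous_intros continuous_translate[OF f] continuous_translate[OF g] f g)
  also have "\<dots> = conv (star f) (star g) x"
    by (simp add: star_def conv_def)
  finally show "star (conv f g) x = conv (star f) (star g) x" .
qed

lemma conv_star_0:
  assumes f: "continuous_on UNIV f"
  shows "conv f (star f) 0 = complex_of_real (L2_square f)"
proof -
  have "conv f (star f) 0 = (LINT y|M. complex_of_real ((cmod (f (- y)))\<^sup>2))"
    by (simp only: conv_def star_def complex_norm_square) simp
  also have "\<dots> = (LINT y|M. complex_of_real ((cmod (f y))\<^sup>2))"
    by (rule integral_uminus) (intro continuous_intros f)
  finally show ?thesis by (simp add: L2_square_def del: of_real_power)
qed

lemma L2_square_translate:
  assumes f: "continuous_on UNIV f"
  shows "L2_square (\<lambda>y. f (x - y)) = L2_square f"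
proof -
  have "complex_of_real (L2_square (\<lambda>y. f (x - y)))
      = (LINT y|M. complex_of_real ((cmod (f (x - y)))\<^sup>2))"
    by (simp add: L2_square_def del: of_real_power)
  also have "\<dots> = (LINT y|M. complex_of_real ((cmod (f y))\<^sup>2))"
    by (rule integral_reflect) (intro continuous_intros f)
  finally show ?thesis by (simp add: L2_square_def del: of_real_power)
qed

text \<open>One convolution turns smallness in L2 into uniform smallness; this is how L2 convergence
  becomes uniform convergence in \<open>top_idempotent\<close>.\<close>

lemma norm_conv_le:
  assumes f: "continuous_on UNIV f" and g: "continuous_on UNIV g"
  shows "(cmod (conv f g x))\<^sup>2 \<le> L2_square f * L2_square g"
proof -
  have "cmod (conv f g x) \<le> (LINT y|M. cmod (f (x - y)) * cmod (g y))"
    unfolding conv_def norm_mult[symmetric] by (rule integral_norm_bound)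
  then have "(cmod (conv f g x))\<^sup>2 \<le> (LINT y|M. cmod (f (x - y)) * cmod (g y))\<^sup>2"
    by (rule power_mono) simp
  also have "\<dots> \<le> L2_square (\<lambda>y. f (x - y)) * L2_square g"
    by (rule L2_Cauchy_Schwarz) (intro continuous_translate[OF f] continuous_translate[OF g] f g)+
  finally show ?thesis by (simp add: L2_square_translate f)
qed

lemma L2_square_pos:
  assumes "continuous_on UNIV f" "f x \<noteq> 0"
  shows "0 < L2_square f"
  using integral_norm_square_pos[OF assms] by (simp add: L2_square_def)

end

section \<open>Top eigenspaces by power iteration\<close>

text \<open>Log-convexity makes the ratios \<open>r\<close> increase and submultiplicativity bounds
  them by \<open>m 1\<close>; \<open>l\<close> is their limit. As no ratio exceeds \<open>l\<close>,
  the quotients \<open>m n / l ^ n\<close> decrease, and \<open>ge\<close> keeps them from falling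
  below 1. In the application \<open>l\<close> is the largest eigenvalue of convolution by
  \<open>conv h h\<close>, and \<open>L\<close> is the dimension of its eigenspace.\<close>

lemma log_convex_submultiplicative_limit:
  fixes m :: "nat \<Rightarrow> real"
  assumes pos: "\<And>n. n \<ge> 1 \<Longrightarrow> m n > 0"
    and log_convex: "\<And>n. n \<ge> 1 \<Longrightarrow> (m (n + 1))\<^sup>2 \<le> m n * m (n + 2)"
    and submult: "\<And>i j. i \<ge> 1 \<Longrightarrow> j \<ge> 1 \<Longrightarrow> m (i + j) \<le> m i * m j"
  obtains l L where "l > 0" "L \<ge> 1" "(\<lambda>n. m n / l ^ n) \<longlonglongrightarrow> L"
    "\<And>n. n \<ge> 1 \<Longrightarrow> m n / l ^ n \<le> m 1 / l"
proof -
  define r where "r n = m (n + 2) / m (n + 1)" for n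
  have "incseq r"
  proof (rule incseq_SucI)
    fix n
    show "r n \<le> r (Suc n)"
      using log_convex[of "n + 1"] pos[of "n + 1"] pos[of "n + 2"]
      by (simp add: r_def field_simps power2_eq_square numeral_3_eq_3)
  qed
  moreover have "r n \<le> m 1" for n
    using submult[of "n + 1" 1] pos[of "n + 1"] by (simp add: r_def field_simps)
  ultimately obtain l where l: "r \<longlonglongrightarrow> l" "\<And>n. r n \<le> l"
    using incseq_convergent[of r "m 1"] by auto
  have r_pos: "r n > 0" for n
    using pos[of "n + 1"] pos[of "n + 2"] by (simp add: r_def)
  have l_pos: "l > 0" using r_pos[of 0] l(2)[of 0] by simp
  define a where "a n = m (Suc n) / l ^ Suc n" for n
  have "decseq a"
  proof (rule decseq_SucI)
    fix n
    have "a (Suc n) = a n * (r n / l)"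
      using pos[of "n + 1"] l_pos by (simp add: a_def r_def field_simps)
    also have "\<dots> \<le> a n * 1"
      using l(2)[of n] l_pos pos[of "Suc n"] by (intro mult_left_mono) (auto simp: a_def)
    finally show "a (Suc n) \<le> a n" by simp
  qed
  have mult_pow: "m (N * Suc j) \<le> m N ^ Suc j" if "N \<ge> 1" for N j
  proof (induction j)
    case (Suc j)
    have "m (N * Suc (Suc j)) = m (N + N * Suc j)" by simp
    also have "\<dots> \<le> m N * m (N * Suc j)"
      using that by (intro submult) auto
    also have "\<dots> \<le> m N * m N ^ Suc j"
      using Suc pos[OF that] by (intro mult_left_mono) auto
    finally show ?case by simp
  qed simp
  \<comment> \<open>If \<open>m N < l ^ N\<close>, some \<open>\<mu> < l\<close> still has
    \<open>m N < \<mu> ^ N\<close>. The ratios eventually exceed \<open>\<mu>\<close>, so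
    \<open>m\<close> grows at least like powers of \<open>\<mu>\<close>, whereas along multiples of
    \<open>N\<close> submultiplicativity allows only powers of \<open>m N\<close>.\<close>
  have ge: "l ^ N \<le> m N" if N: "N \<ge> 1" for N
  proof (rule ccontr)
    assume "\<not> l ^ N \<le> m N"
    then have less: "m N < l ^ N" by simp
    define \<mu> where "\<mu> = (root N (m N) + l) / 2"
    have root: "root N (m N) \<ge> 0" "root N (m N) ^ N = m N"
      using pos[OF N] N by (auto intro!: real_root_pow_pos2)
    then have "root N (m N) < l"
      using less l_pos by (metis less_eq_real_def power_less_imp_less_base)
    then have mu: "\<mu> > 0" "\<mu> < l" "root N (m N) < \<mu>"
      using l_pos root(1) by (auto simp: \<mu>_def)
    have mN: "m N < \<mu> ^ N"
      using power_strict_mono[OF mu(3) root(1), of N] N root(2) by simp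
    obtain k where k: "\<And>n. n \<ge> k \<Longrightarrow> \<mu> < r n"
      using order_tendstoD(1)[OF l(1) mu(2)] by (auto simp: eventually_sequentially)
    have lower: "m (k + 1) * \<mu> ^ j \<le> m (k + 1 + j)" for j
    proof (induction j)
      case (Suc j)
      have "m (k + 1) * \<mu> ^ Suc j \<le> m (k + 1 + j) * \<mu>"
        using mult_right_mono[OF Suc less_imp_le[OF mu(1)]] by (simp add: mult_ac)
      also have "\<dots> \<le> m (k + 1 + j) * r (k + j)"
        using k[of "k + j"] pos[of "k + 1 + j"] by (intro mult_left_mono) auto
      also have "\<dots> = m (k + 1 + Suc j)"
        using pos[of "k + 1 + j"] by (simp add: r_def)
      finally show ?case .
    qed simp
    define c where "c = m (k + 1) / \<mu> ^ (k + 1)"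
    have c: "c > 0" using pos[of "k + 1"] mu by (simp add: c_def)
    \<comment> \<open>For \<open>j \<ge> k\<close> the index \<open>N * Suc j\<close> is at least
      \<open>k + 1\<close>, where \<open>lower\<close> applies.\<close>
    have upper: "c \<le> (m N / \<mu> ^ N) ^ Suc j" if j: "j \<ge> k" for j
    proof -
      have "k + 1 \<le> N * Suc j" using j N by (metis Suc_eq_plus1 Suc_le_mono le_trans mult_1 mult_le_mono1)
      then obtain i where i: "N * Suc j = k + 1 + i" using le_Suc_ex by blast
      have "m (k + 1) * \<mu> ^ i \<le> m N ^ Suc j"
        using lower[of i] mult_pow[OF N, of j] i by simp
      then have "m (k + 1) * \<mu> ^ i / \<mu> ^ (N * Suc j) \<le> m N ^ Suc j / \<mu> ^ (N * Suc j)"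
        using mu by (intro divide_right_mono) auto
      also have "m (k + 1) * \<mu> ^ i / \<mu> ^ (N * Suc j) = c"
        using mu unfolding i c_def by (simp add: power_add)
      finally show ?thesis by (simp only: power_divide power_mult)
    qed
    have "(\<lambda>j. (m N / \<mu> ^ N) ^ Suc j) \<longlonglongrightarrow> 0"
      using mN pos[OF N] mu by (intro LIMSEQ_Suc LIMSEQ_realpow_zero) auto
    then have "c \<le> 0"
      by (rule LIMSEQ_le_const) (use upper in blast)
    then show False using c by simp
  qed
  have a_ge: "1 \<le> a n" for n
    using ge[of "Suc n"] l_pos by (simp add: a_def field_simps)
  obtain L where L: "a \<longlonglongrightarrow> L" "\<And>n. L \<le> a n"
    using decseq_convergent[OF \<open>decseq a\<close>, of 1] a_ge by auto
  show thesis
  proof (rule that[OF l_pos])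
    show "1 \<le> L" using LIMSEQ_le_const[OF L(1)] a_ge by blast
    show "(\<lambda>n. m n / l ^ n) \<longlonglongrightarrow> L"
      using L(1) unfolding a_def by (rule LIMSEQ_imp_Suc)
    show "m n / l ^ n \<le> m 1 / l" if n: "n \<ge> 1" for n
    proof -
      have "a (n - 1) \<le> a 0" using \<open>decseq a\<close> by (simp add: decseq_def)
      then show ?thesis using n by (simp add: a_def)
    qed
  qed
qed

context compact_haar_group
begin

text \<open>Convolution by such a function is the orthogonal projection of L2 onto a nonzero
  finite-dimensional translation-invariant subspace, and \<open>e 0\<close> is the dimension of that
  subspace.\<close>

definition idempotent :: "('a \<Rightarrow> complex) \<Rightarrow> bool" where
  "idempotent e \<longleftrightarrow> continuous_on UNIV e \<and> star e = e \<and> conv e e = e \<and> (\<exists>x. e x \<noteq> 0)"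

lemma conv_tendsto:
  assumes f: "\<And>n. continuous_on UNIV (f n)" and g: "\<And>n. continuous_on UNIV (g n)"
    and F: "continuous_on UNIV F" and G: "continuous_on UNIV G"
    and A: "\<And>n x. cmod (f n x) \<le> A" and B: "\<And>n x. cmod (g n x) \<le> B"
    and fF: "\<And>x. (\<lambda>n. f n x) \<longlonglongrightarrow> F x" and gG: "\<And>x. (\<lambda>n. g n x) \<longlonglongrightarrow> G x"
  shows "(\<lambda>n. conv (f n) (g n) x) \<longlonglongrightarrow> conv F G x"
  unfolding conv_def
proof (rule integral_dominated_convergence[where w = "\<lambda>_. A * B"])
  have "A \<ge> 0" using A[of 0 0] norm_ge_zero order_trans by blast
  then show "AE y in M. cmod (f n (x - y) * g n y) \<le> A * B" for n
    using A B by (auto simp: norm_mult intro!: mult_mono)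
  show "AE y in M. (\<lambda>n. f n (x - y) * g n y) \<longlonglongrightarrow> F (x - y) * G y"
    by (intro AE_I2 tendsto_mult fF gG)
qed (use continuous_conv_integrand[OF F G] continuous_conv_integrand[OF f g]
    in \<open>auto intro: continuous_imp_measurable\<close>)

text \<open>Power iteration: the normalised even convolution powers of \<open>h\<close> converge uniformly to the
  projection onto the top eigenspace of convolution by \<open>h * h\<close>.\<close>

lemma top_idempotent:
  assumes h: "continuous_on UNIV h" and star_h: "star h = h" and "h x0 \<noteq> 0"
  obtains e l where "idempotent e" "l > 0"
    "conv (conv h h) e = (\<lambda>x. complex_of_real l * e x)"
    "\<And>g. continuous_on UNIV g \<Longrightarrow> conv g h = h \<Longrightarrow> conv g e = e"
proof -
  \<comment> \<open>The \<open>n\<close>-th convolution power of \<open>h\<close> for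
    \<open>n \<ge> 1\<close>. The algebra need not have a unit: \<open>p 0\<close> is the default
    value \<open>h\<close>, and the power laws start at 1.\<close>
  define p where "p n = (conv h ^^ (n - 1)) h" for n :: nat
  have p1: "p 1 = h" by (simp add: p_def)
  have p_Suc: "p (Suc n) = conv h (p n)" if "n \<ge> 1" for n
  proof -
    obtain k where "n = Suc k" using \<open>n \<ge> 1\<close> by (cases n) auto
    then show ?thesis by (simp add: p_def)
  qed
  have p_cont: "continuous_on UNIV (p n)" if "n \<ge> 1" for n
    using that by (induction n rule: nat_induct_at_least) (use h in \<open>auto simp: p1[simplified] p_Suc continuous_conv\<close>)
  have p_add: "conv (p i) (p j) = p (i + j)" if "i \<ge> 1" "j \<ge> 1" for i j
    using that(1)
  proof (induction i rule: nat_induct_at_least)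
    case base
    then show ?case using p_Suc[OF that(2)] p1 by simp
  next
    case (Suc n)
    then show ?case
      using p_cont[of n] p_cont[OF that(2)] h by (simp add: p_Suc conv_assoc)
  qed
  have p_star: "star (p n) = p n" if "n \<ge> 1" for n
    using that
  proof (induction n rule: nat_induct_at_least)
    case base
    then show ?case using star_h p1 by simp
  next
    case (Suc n)
    then show ?case
      using p_cont[of n] h star_h by (simp add: p_Suc star_conv)
  qed
  define m where "m n = L2_square (p n)" for n
  have p_0: "p (2 * n) 0 = complex_of_real (m n)" if "n \<ge> 1" for n
    using conv_star_0[OF p_cont[OF that]] that by (simp add: p_star p_add m_def mult_2)
  have p_le: "(cmod (p (i + j) x))\<^sup>2 \<le> m i * m j" if "i \<ge> 1" "j \<ge> 1" for i j x
    using norm_conv_le[OF p_cont[OF that(1)] p_cont[OF that(2)]] that by (simp add: p_add m_def)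
  have m_nonneg: "0 \<le> m n" for n by (simp add: m_def)
  have p_le_m: "cmod (p (2 * n) x) \<le> m n" if "n \<ge> 1" for n x
  proof (rule power2_le_imp_le)
    show "(cmod (p (2 * n) x))\<^sup>2 \<le> (m n)\<^sup>2"
      using p_le[OF that that, of x] unfolding mult_2 power2_eq_square[of "m n"] .
  qed (rule m_nonneg)
  \<comment> \<open>\<open>m (i + j)\<close> is the value at 0 of a product of two even powers,
    which \<open>p_le_m\<close> bounds pointwise by \<open>m i\<close> and \<open>m j\<close>; the
    total mass is 1.\<close>
  have submult: "m (i + j) \<le> m i * m j" if "i \<ge> 1" "j \<ge> 1" for i j
  proof -
    have "conv (p (2 * i)) (p (2 * j)) 0 = complex_of_real (m (i + j))"
      using that p_0[of "i + j"] by (simp add: p_add distrib_left)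
    moreover have "cmod (conv (p (2 * i)) (p (2 * j)) 0) \<le> m i * m j"
      unfolding conv_def
    proof (rule norm_integral_le)
      show "continuous_on UNIV (\<lambda>y. p (2 * i) (0 - y) * p (2 * j) y)"
        using that by (intro continuous_conv_integrand p_cont) auto
      show "cmod (p (2 * i) (0 - y) * p (2 * j) y) \<le> m i * m j" for y
        unfolding norm_mult using p_le_m[OF that(1)] p_le_m[OF that(2)] m_nonneg
        by (intro mult_mono) auto
    qed
    ultimately show ?thesis using m_nonneg by simp
  qed
  \<comment> \<open>Cauchy--Schwarz for \<open>p (2 * (n + 1)) = conv (p n) (p (n + 2))\<close> at
    0.\<close>
  have log_convex: "(m (n + 1))\<^sup>2 \<le> m n * m (n + 2)" if "n \<ge> 1" for n
    using p_le[of n "n + 2" 0] p_0[of "n + 1"] that m_nonneg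
    by (simp add: mult_2)
  have m1: "m 1 > 0"
    using L2_square_pos[OF h \<open>h x0 \<noteq> 0\<close>] unfolding m_def p1 .
  have m2: "m 2 > 0"
    unfolding m_def
  proof (rule L2_square_pos)
    show "continuous_on UNIV (p 2)" by (rule p_cont) simp
    show "p 2 0 \<noteq> 0" using p_0[of 1] m1 by simp
  qed
  \<comment> \<open>Log-convexity passes positivity on from two consecutive terms, hence the
    induction over pairs.\<close>
  have m_pos2: "m n > 0 \<and> m (Suc n) > 0" if "n \<ge> 1" for n
    using that
  proof (induction n rule: nat_induct_at_least)
    case base
    then show ?case using m1 m2 by (simp add: numeral_2_eq_2)
  next
    case (Suc n)
    then have "0 < m n * m (n + 2)"
      using log_convex[of n] by (smt (verit) Suc_eq_plus1 zero_less_power)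
    then show ?case using Suc by (simp add: zero_less_mult_iff)
  qed
  then have m_pos: "m n > 0" if "n \<ge> 1" for n using that by blast
  obtain l L where l: "l > 0" and L: "L \<ge> 1" and lim: "(\<lambda>n. m n / l ^ n) \<longlonglongrightarrow> L"
    and m_le: "\<And>n. n \<ge> 1 \<Longrightarrow> m n / l ^ n \<le> m 1 / l"
    using log_convex_submultiplicative_limit[OF m_pos log_convex submult] by blast
  define c where "c n = complex_of_real (1 / l ^ n)" for n :: nat
  define u where "u n = (\<lambda>x. c n * p (2 * n) x)" for n
  have c_add: "c i * c j = c (i + j)" for i j by (simp add: c_def power_add)
  have u_cont: "continuous_on UNIV (u n)" if "n \<ge> 1" for n
    unfolding u_def using that by (intro continuous_intros p_cont) auto
  have u_star: "star (u n) = u n" if "n \<ge> 1" for n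
  proof -
    have "star (u n) = (\<lambda>x. c n * star (p (2 * n)) x)"
      by (simp add: star_def u_def c_def fun_eq_iff)
    then show ?thesis using p_star[of "2 * n"] that by (simp add: u_def)
  qed
  have u_add: "conv (u i) (u j) = u (i + j)" if "i \<ge> 1" "j \<ge> 1" for i j
  proof -
    have "conv (u i) (u j) x = c (i + j) * conv (p (2 * i)) (p (2 * j)) x" for x
      by (simp add: u_def conv_scale c_add[symmetric])
    then show ?thesis
      using that by (simp add: fun_eq_iff u_def p_add distrib_left)
  qed
  have u_0: "u n 0 = complex_of_real (m n / l ^ n)" if "n \<ge> 1" for n
    using that by (simp add: u_def c_def p_0)
  have u_le: "cmod (u n x) \<le> m 1 / l" if "n \<ge> 1" for n x
  proof -
    have "cmod (u n x) \<le> m n / l ^ n"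
      using p_le_m[OF that, of x] l
      by (simp add: u_def c_def norm_mult norm_divide norm_power divide_right_mono)
    then show ?thesis using m_le[OF that] by simp
  qed
  \<comment> \<open>All three quotients tend to \<open>L\<close>, so the right-hand side tends to
    \<open>L + L - 2 * L = 0\<close> and \<open>u\<close> is Cauchy in L2.\<close>
  have diff: "L2_square (\<lambda>x. u i x - u j x)
      = m (2 * i) / l ^ (2 * i) + m (2 * j) / l ^ (2 * j) - 2 * (m (i + j) / l ^ (i + j))"
    if "i \<ge> 1" "j \<ge> 1" for i j
  proof -
    let ?d = "\<lambda>x. 1 * u i x + (- 1) * u j x"
    have d: "continuous_on UNIV ?d" using u_cont that by (intro continuous_intros)
    have "star ?d = ?d"
      using u_star[OF that(1)] u_star[OF that(2)] by (simp add: star_def fun_eq_iff)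
    then have "complex_of_real (L2_square ?d) = conv ?d ?d 0"
      using conv_star_0[OF d] by simp
    also have "\<dots> = u (i + i) 0 - 2 * u (i + j) 0 + u (j + j) 0"
      using that u_cont d
      by (simp only: conv_linear_left conv_linear_right u_add add.commute[of j i]) simp
    also have "\<dots> = complex_of_real (m (2 * i) / l ^ (2 * i) + m (2 * j) / l ^ (2 * j)
        - 2 * (m (i + j) / l ^ (i + j)))"
      using u_0[of "i + i"] u_0[of "i + j"] u_0[of "j + j"] that unfolding mult_2 by simp
    finally have "L2_square ?d = m (2 * i) / l ^ (2 * i) + m (2 * j) / l ^ (2 * j)
        - 2 * (m (i + j) / l ^ (i + j))"
      by (simp only: of_real_eq_iff)
    then show ?thesis by simp
  qed
  \<comment> \<open>A further convolution with \<open>u 1\<close> makes the Cauchy property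
    uniform.\<close>
  have step: "(cmod (u (Suc i) x - u (Suc j) x))\<^sup>2 \<le> L2_square (u 1) * L2_square (\<lambda>x. u i x - u j x)"
    if "i \<ge> 1" "j \<ge> 1" for i j x
  proof -
    have "conv (u 1) (\<lambda>x. 1 * u i x + (- 1) * u j x) x = u (Suc i) x - u (Suc j) x"
      using that by (subst conv_linear_right) (simp_all add: u_cont u_add)
    moreover have "continuous_on UNIV (\<lambda>x. u i x - u j x)"
      using that by (intro continuous_intros u_cont)
    ultimately show ?thesis
      using norm_conv_le[of "u 1" "\<lambda>x. u i x - u j x" x] u_cont[of 1] by simp
  qed
  \<comment> \<open>The estimate \<open>step\<close> covers the indices from 2 on.\<close>
  define v where "v n = u (n + 2)" for n
  have "uniformly_Cauchy_on UNIV v"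
  proof (rule uniformly_Cauchy_onI')
    fix \<epsilon> :: real assume "\<epsilon> > 0"
    define \<delta> where "\<delta> = \<epsilon>\<^sup>2 / (L2_square (u 1) + 1)"
    have \<delta>: "\<delta> > 0" "L2_square (u 1) * \<delta> < \<epsilon>\<^sup>2"
    proof -
      have pos: "L2_square (u 1) + 1 > 0" using L2_square_nonneg[of "u 1"] by linarith
      then show "\<delta> > 0" using \<open>\<epsilon> > 0\<close> by (simp add: \<delta>_def)
      moreover have "L2_square (u 1) * \<delta> + \<delta> = \<epsilon>\<^sup>2"
        using pos by (simp add: \<delta>_def flip: distrib_right add_divide_distrib) (simp add: field_simps)
      ultimately show "L2_square (u 1) * \<delta> < \<epsilon>\<^sup>2" by linarith
    qed
    \<comment> \<open>The quotients enter \<open>diff\<close> with weights 1, 1 and 2 in absolute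
      value, which accounts for the 4.\<close>
    have "\<forall>\<^sub>F n in sequentially. dist (m n / l ^ n) L < \<delta> / 4"
      using lim \<delta>(1) by (intro tendstoD) auto
    then obtain N where N: "\<And>n. n \<ge> N \<Longrightarrow> \<bar>m n / l ^ n - L\<bar> < \<delta> / 4"
      by (auto simp: eventually_sequentially dist_real_def)
    have "dist (v i x) (v j x) < \<epsilon>" if "i \<ge> N" "j > i" for i j x
    proof -
      have "L2_square (\<lambda>x. u (i + 1) x - u (j + 1) x) < \<delta>"
      proof -
        have "\<bar>m (2 * (i + 1)) / l ^ (2 * (i + 1)) - L\<bar> < \<delta> / 4"
          "\<bar>m (2 * (j + 1)) / l ^ (2 * (j + 1)) - L\<bar> < \<delta> / 4"
          "\<bar>m (i + 1 + (j + 1)) / l ^ (i + 1 + (j + 1)) - L\<bar> < \<delta> / 4"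
          by (rule N, use that in simp)+
        then show ?thesis
          using diff[of "i + 1" "j + 1"] unfolding abs_less_iff by linarith
      qed
      then have "L2_square (u 1) * L2_square (\<lambda>x. u (i + 1) x - u (j + 1) x) \<le> L2_square (u 1) * \<delta>"
        by (intro mult_left_mono) auto
      then have "(cmod (v i x - v j x))\<^sup>2 < \<epsilon>\<^sup>2"
        using step[of "i + 1" "j + 1" x] \<delta>(2) by (simp add: v_def)
      then show ?thesis
        using \<open>\<epsilon> > 0\<close> by (auto simp: dist_norm intro: power2_less_imp_less)
    qed
    then show "\<exists>N. \<forall>x\<in>UNIV. \<forall>i\<ge>N. \<forall>j>i. dist (v i x) (v j x) < \<epsilon>" by blast
  qed
  then obtain e where e: "uniform_limit UNIV v e sequentially"
    using uniformly_convergent_eq_Cauchy uniformly_convergent_on_def by blast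
  have v_cont: "continuous_on UNIV (v n)" for n by (simp add: v_def u_cont)
  have e_cont: "continuous_on UNIV e"
    by (rule uniform_limit_theorem[OF _ e]) (auto simp: v_cont)
  have v_lim: "(\<lambda>n. v n x) \<longlonglongrightarrow> e x" for x
    using tendsto_uniform_limitI[OF e] by simp
  have v_le: "cmod (v n x) \<le> m 1 / l" for n x unfolding v_def by (rule u_le) simp
  have sub: "(\<lambda>n. u (f n) x) \<longlonglongrightarrow> e x" if f: "\<And>n. f n \<ge> n + 2" for f x
  proof -
    have "filterlim (\<lambda>n. f n - 2) sequentially sequentially"
    proof (rule filterlim_at_top_mono[OF filterlim_ident])
      have "n \<le> f n - 2" for n using f[of n] by simp
      then show "\<forall>\<^sub>F n in sequentially. n \<le> f n - 2" by simp
    qed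
    from filterlim_compose[OF v_lim[of x] this]
    have "(\<lambda>n. u (f n - 2 + 2) x) \<longlonglongrightarrow> e x" by (simp only: v_def)
    moreover have "f n - 2 + 2 = f n" for n using f[of n] by linarith
    ultimately show ?thesis by simp
  qed
  \<comment> \<open>Here \<open>L \<ge> 1\<close> ensures that the limit function does not
    vanish.\<close>
  have "e 0 = complex_of_real L"
  proof (rule LIMSEQ_unique[OF v_lim])
    have "(\<lambda>n. complex_of_real (m (n + 2) / l ^ (n + 2))) \<longlonglongrightarrow> complex_of_real L"
      by (intro tendsto_of_real LIMSEQ_ignore_initial_segment[OF lim])
    then show "(\<lambda>n. v n 0) \<longlonglongrightarrow> complex_of_real L"
      by (simp add: v_def u_0 del: of_real_divide power_add)
  qed
  then have e_0: "e 0 \<noteq> 0" using L by auto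
  have e_star: "star e = e"
  proof
    fix x
    have "(\<lambda>n. cnj (v n (- x))) \<longlonglongrightarrow> cnj (e (- x))"
      by (intro tendsto_cnj v_lim)
    moreover have "cnj (v n (- x)) = v n x" for n
      using u_star[of "n + 2"] by (simp add: v_def star_def fun_eq_iff)
    ultimately show "star e x = e x"
      using LIMSEQ_unique[OF v_lim[of x]] by (simp add: star_def)
  qed
  have e_idem: "conv e e = e"
  proof
    fix x
    have "(\<lambda>n. conv (v n) (v n) x) \<longlonglongrightarrow> conv e e x"
      by (rule conv_tendsto[OF v_cont v_cont e_cont e_cont v_le v_le v_lim v_lim])
    moreover have "(\<lambda>n. conv (v n) (v n) x) \<longlonglongrightarrow> e x"
      using sub[of "\<lambda>n. n + 2 + (n + 2)" x] by (simp add: v_def u_add)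
    ultimately show "conv e e x = e x" by (rule LIMSEQ_unique)
  qed
  have conv_e_lim: "(\<lambda>n. conv g (v n) x) \<longlonglongrightarrow> conv g e x" if g: "continuous_on UNIV g" for g x
  proof -
    obtain B where "\<And>x. cmod (g x) \<le> B" using continuous_imp_bounded[OF g] by metis
    then show ?thesis
      by (rule conv_tendsto[OF g v_cont g e_cont _ v_le tendsto_const v_lim])
  qed
  have hh: "continuous_on UNIV (conv h h)" by (intro continuous_conv h)
  \<comment> \<open>As \<open>conv h h = p 2\<close>, convolution with it raises the index of
    \<open>u\<close> by one at the price of a factor \<open>l\<close>; then pass to the
    limit.\<close>
  have eigen: "conv (conv h h) e = (\<lambda>x. complex_of_real l * e x)"
  proof
    fix x
    have "conv (conv h h) (v n) x = complex_of_real l * u (n + 3) x" for n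
    proof -
      have "conv (p 2) (p (2 * (n + 2))) = p (2 * (n + 3))"
      proof -
        have "conv (p 2) (p (2 * (n + 2))) = p (2 + 2 * (n + 2))" by (rule p_add) auto
        also have "2 + 2 * (n + 2) = 2 * (n + 3)" by simp
        finally show ?thesis .
      qed
      moreover have "conv h h = p 2" using p_Suc[of 1] p1 by (simp add: numeral_2_eq_2)
      ultimately have "conv (conv h h) (v n) x = c (n + 2) * p (2 * (n + 3)) x"
        by (simp only: v_def u_def conv_scale)
      also have "c (n + 2) = complex_of_real l * c (n + 3)"
        using l by (simp add: c_def power_add field_simps power2_eq_square power3_eq_cube)
      finally show ?thesis by (simp add: u_def)
    qed
    then have "(\<lambda>n. conv (conv h h) (v n) x) \<longlonglongrightarrow> complex_of_real l * e x"
      using tendsto_mult_left[OF sub[of "\<lambda>n. n + 3" x]] by simp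
    then show "conv (conv h h) e x = complex_of_real l * e x"
      using conv_e_lim[OF hh] LIMSEQ_unique by blast
  qed
  show thesis
  proof (rule that[OF _ l eigen])
    show "idempotent e"
      using e_cont e_star e_idem e_0 by (auto simp: idempotent_def)
    \<comment> \<open>A function that fixes \<open>h\<close> fixes all its powers and hence their
      limit. With an idempotent for \<open>g\<close> this keeps \<open>e\<close> inside the corner
      that contains \<open>h\<close>.\<close>
    fix g assume g: "continuous_on UNIV g" and gh: "conv g h = h"
    have gp: "conv g (p n) = p n" if "n \<ge> 1" for n
      using that
    proof (induction n rule: nat_induct_at_least)
      case base
      then show ?case using gh p1 by simp
    next
      case (Suc n)
      then show ?case
        using conv_assoc[OF g h p_cont[of n]] gh by (simp add: p_Suc)
    qed
    show "conv g e = e"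
    proof
      fix x
      have "conv g (v n) x = v n x" for n
        by (simp add: v_def u_def conv_scale gp)
      then show "conv g e x = e x"
        using conv_e_lim[OF g, of x] v_lim[of x] LIMSEQ_unique by simp
    qed
  qed
qed

end

section \<open>Existence of characters\<close>

lemma continuous_char_fun: "continuous_on UNIV (char_fun \<gamma>)"
  and norm_char_fun [simp]: "cmod (char_fun \<gamma> x) = 1"
  and char_fun_add: "char_fun \<gamma> (x + y) = char_fun \<gamma> x * char_fun \<gamma> y"
  using char_fun[of \<gamma>] by auto

lemma char_fun_nonzero [simp]: "char_fun \<gamma> x \<noteq> 0"
  using norm_char_fun[of \<gamma> x] by (metis norm_zero zero_neq_one)

lemma char_fun_0 [simp]: "char_fun \<gamma> 0 = 1"
  using char_fun_add[of \<gamma> 0 0] by simp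

lemma char_fun_mult_cnj [simp]: "char_fun \<gamma> x * cnj (char_fun \<gamma> x) = 1"
  using complex_norm_square[of "char_fun \<gamma> x"] by simp

lemma char_fun_diff: "char_fun \<gamma> (x - y) = char_fun \<gamma> x * cnj (char_fun \<gamma> y)"
proof -
  have "char_fun \<gamma> (x - y) * char_fun \<gamma> y = char_fun \<gamma> x"
    using char_fun_add[of \<gamma> "x - y" y] by simp
  then have "char_fun \<gamma> (x - y) * (char_fun \<gamma> y * cnj (char_fun \<gamma> y)) = char_fun \<gamma> x * cnj (char_fun \<gamma> y)"
    by (simp only: mult.assoc[symmetric])
  then show ?thesis by simp
qed

lemma ex_char_fun:
  assumes "continuous_on UNIV f" "\<And>x. cmod (f x) = 1" "\<And>x y. f (x + y) = f x * f y"
  obtains \<gamma> where "char_fun \<gamma> = f"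
  using Abs_dual_inverse[of f] assms by auto

section \<open>Minimal idempotents are multiples of characters\<close>

context compact_haar_group
begin

text \<open>Since \<open>e = conv e (star e)\<close>, the value at 0 is
  \<open>s = L2_square e\<close>, and Cauchy--Schwarz bounds \<open>e\<close> by \<open>s\<close>.
  Inserting this bound into \<open>conv e e 0 = e 0\<close> gives \<open>s \<le> s * s\<close> with
  \<open>s > 0\<close>, so \<open>1 \<le> s\<close>.\<close>

lemma idempotent_value_0:
  assumes "idempotent e"
  shows "e 0 = complex_of_real (L2_square e)" "1 \<le> L2_square e"
    "\<And>x. cmod (e x) \<le> L2_square e"
proof -
  have e: "continuous_on UNIV e" "star e = e" "conv e e = e"
    using assms by (auto simp: idempotent_def)
  show e0: "e 0 = complex_of_real (L2_square e)"
    using conv_star_0[OF e(1)] e by simp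
  show le: "cmod (e x) \<le> L2_square e" for x
  proof (rule power2_le_imp_le)
    show "(cmod (e x))\<^sup>2 \<le> (L2_square e)\<^sup>2"
      using norm_conv_le[OF e(1) e(1), of x] e(3) by (simp add: power2_eq_square)
  qed simp
  have pos: "0 < L2_square e"
    using assms L2_square_pos by (auto simp: idempotent_def)
  have "cmod (conv e e 0) \<le> L2_square e * L2_square e"
    unfolding conv_def
  proof (rule norm_integral_le[OF continuous_conv_integrand[OF e(1) e(1)]])
    show "cmod (e (0 - y) * e y) \<le> L2_square e * L2_square e" for y
      unfolding norm_mult by (intro mult_mono le) auto
  qed
  then have "L2_square e * 1 \<le> L2_square e * L2_square e"
    using e(3) e0 by simp
  then show "1 \<le> L2_square e"
    using pos by (simp only: mult_le_cancel_left_pos)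
qed

text \<open>The difference of \<open>e\<close> and \<open>e'\<close> is itself a nonzero
  self-adjoint idempotent, so its value at 0 is at least 1; values at 0 are squared norms and
  subtract.\<close>

lemma idempotent_diff:
  assumes "idempotent e" "idempotent e'" "conv e e' = e'" "e' \<noteq> e"
  shows "L2_square e' \<le> L2_square e - 1"
proof -
  have e: "continuous_on UNIV e" "star e = e" "conv e e = e"
    and e': "continuous_on UNIV e'" "star e' = e'" "conv e' e' = e'"
    using assms(1,2) by (auto simp: idempotent_def)
  have ee': "conv e' e = e'" using conv_commute[OF e(1) e'(1)] assms(3) by simp
  let ?d = "\<lambda>x. 1 * e x + (- 1) * e' x"
  have d: "continuous_on UNIV ?d" by (intro continuous_intros e e')
  have "idempotent ?d"
    unfolding idempotent_def
  proof (intro conjI d)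
    show "star ?d = ?d"
      using e(2) e'(2) by (simp add: star_def fun_eq_iff)
    show "conv ?d ?d = ?d"
    proof
      fix x
      show "conv ?d ?d x = ?d x"
        using e e' ee' assms(3) d by (simp only: conv_linear_left conv_linear_right) simp
    qed
    show "\<exists>x. ?d x \<noteq> 0" using assms(4) by (simp add: fun_eq_iff) metis
  qed
  from idempotent_value_0(1,2)[OF this]
  have "complex_of_real (L2_square e - L2_square e') = complex_of_real (L2_square ?d)" "1 \<le> L2_square ?d"
    by (simp_all add: idempotent_value_0(1)[OF assms(1)] idempotent_value_0(1)[OF assms(2)])
  then show ?thesis by (simp only: of_real_eq_iff)
qed

text \<open>\<open>L2_square\<close> drops by at least 1 on passing to a proper subidempotent, so
  its integer part is a natural number that can be minimised among the idempotents below
  \<open>e0\<close>.\<close>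

lemma minimal_idempotent:
  assumes "idempotent e0"
  obtains e where "idempotent e" "conv e0 e = e"
    "\<And>e'. idempotent e' \<Longrightarrow> conv e e' = e' \<Longrightarrow> e' = e"
proof -
  let ?Q = "\<lambda>e. idempotent e \<and> conv e0 e = e"
  have "?Q e0" using assms by (auto simp: idempotent_def)
  then obtain e where e: "?Q e" "\<And>e'. ?Q e' \<Longrightarrow> nat \<lfloor>L2_square e\<rfloor> \<le> nat \<lfloor>L2_square e'\<rfloor>"
    using ex_has_least_nat[of ?Q e0 "\<lambda>e. nat \<lfloor>L2_square e\<rfloor>"] by blast
  have "e' = e" if e': "idempotent e'" "conv e e' = e'" for e'
  proof (rule ccontr)
    assume "e' \<noteq> e"
    then have "L2_square e' \<le> L2_square e - 1" using idempotent_diff e e' by blast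
    moreover have "1 \<le> L2_square e'" using idempotent_value_0(2)[OF e'(1)] .
    ultimately have "nat \<lfloor>L2_square e'\<rfloor> < nat \<lfloor>L2_square e\<rfloor>" by linarith
    moreover have "conv e0 e' = e'"
      using conv_assoc[of e0 e e'] assms e(1) e' by (auto simp: idempotent_def)
    ultimately show False using e(2)[of e'] e'(1) by (meson leD)
  qed
  then show thesis using that e by blast
qed

text \<open>If every self-adjoint \<open>h\<close> in the corner \<open>e * C(G)\<close> has its square in \<open>\<complex> e\<close>, then polarising
  with \<open>h + e\<close> shows that the corner is one-dimensional.\<close>

lemma minimal_idempotent_corner:
  assumes e: "idempotent e" and minimal: "\<And>e'. idempotent e' \<Longrightarrow> conv e e' = e' \<Longrightarrow> e' = e"
    and u: "continuous_on UNIV u" "conv e u = u"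
  obtains c where "\<And>x. u x = c * e x"
proof -
  have e': "continuous_on UNIV e" "star e = e" "conv e e = e"
    using e by (auto simp: idempotent_def)
  have square: "\<exists>a. \<forall>x. conv h h x = a * e x"
    if h: "continuous_on UNIV h" "star h = h" "conv e h = h" for h
  proof (cases "\<forall>x. h x = 0")
    case True
    then have "h = (\<lambda>x. 0)" by auto
    then show ?thesis by (auto intro!: exI[of _ 0])
  next
    case False
    then obtain x0 where "h x0 \<noteq> 0" by blast
    from top_idempotent[OF h(1,2) this] obtain f l where
      f: "idempotent f" "conv (conv h h) f = (\<lambda>x. complex_of_real l * f x)"
      "\<And>g. continuous_on UNIV g \<Longrightarrow> conv g h = h \<Longrightarrow> conv g f = f"
      by metis
    \<comment> \<open>\<open>e\<close> fixes \<open>h\<close> and therefore \<open>f\<close>, so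
      minimality identifies \<open>f\<close> with \<open>e\<close>. As \<open>e\<close> also fixes
      \<open>conv h h\<close>, the eigenvalue equation becomes a formula for
      \<open>conv h h\<close>.\<close>
    have "f = e" using minimal f(1) f(3)[OF e'(1) h(3)] by blast
    moreover have "conv (conv h h) e = conv h h"
      using conv_commute[OF continuous_conv[OF h(1) h(1)] e'(1)]
        conv_assoc[OF e'(1) h(1) h(1)] h(3) by simp
    ultimately have "conv h h = (\<lambda>x. complex_of_real l * e x)" using f(2) by simp
    then show ?thesis by auto
  qed
  have selfadj: "\<exists>b. \<forall>x. h x = b * e x"
    if h: "continuous_on UNIV h" "star h = h" "conv e h = h" for h
  proof -
    let ?g = "\<lambda>x. 1 * h x + 1 * e x"
    have g: "continuous_on UNIV ?g" by (intro continuous_intros h e')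
    have he: "conv h e = h" using conv_commute[OF h(1) e'(1)] h(3) by simp
    have "star ?g = ?g" using h(2) e'(2) by (simp add: star_def fun_eq_iff)
    moreover have "conv e ?g = ?g"
      using conv_linear_right[OF h(1) e'(1) e'(1), of 1 1] h(3) e'(3) by (simp add: fun_eq_iff)
    ultimately obtain a' where a': "\<And>x. conv ?g ?g x = a' * e x"
      using square[OF g] by blast
    obtain a where a: "\<And>x. conv h h x = a * e x" using square[OF h] by blast
    have "h x = ((a' - a - 1) / 2) * e x" for x
    proof -
      have "conv ?g ?g x = conv h h x + 2 * h x + e x"
        using h e' he g by (simp only: conv_linear_left conv_linear_right) simp
      then have "a' * e x = a * e x + 2 * h x + e x" using a[of x] a'[of x] by metis
      then show ?thesis by (simp add: field_simps)
    qed
    then show ?thesis by blast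
  qed
  have su: "continuous_on UNIV (star u)" "conv e (star u) = star u"
    using continuous_star[OF u(1)] star_conv[OF e'(1) u(1)] u(2) e'(2) by auto
  \<comment> \<open>\<open>u + star u\<close> and \<open>\<i> * (u - star u)\<close> are
    self-adjoint and stay in the corner, and \<open>u\<close> is a combination of the two.\<close>
  have 1: "\<exists>b. \<forall>x. 1 * u x + 1 * star u x = b * e x"
  proof (rule selfadj)
    show "star (\<lambda>x. 1 * u x + 1 * star u x) = (\<lambda>x. 1 * u x + 1 * star u x)"
      by (simp add: star_def fun_eq_iff)
    show "conv e (\<lambda>x. 1 * u x + 1 * star u x) = (\<lambda>x. 1 * u x + 1 * star u x)"
      using conv_linear_right[OF u(1) su(1) e'(1), of 1 1] su(2) u(2) by (simp add: fun_eq_iff)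
  qed (intro continuous_intros u su)
  have 2: "\<exists>b. \<forall>x. \<i> * u x + (- \<i>) * star u x = b * e x"
  proof (rule selfadj)
    show "star (\<lambda>x. \<i> * u x + (- \<i>) * star u x) = (\<lambda>x. \<i> * u x + (- \<i>) * star u x)"
      by (simp add: star_def fun_eq_iff)
    show "conv e (\<lambda>x. \<i> * u x + (- \<i>) * star u x) = (\<lambda>x. \<i> * u x + (- \<i>) * star u x)"
      using conv_linear_right[OF u(1) su(1) e'(1), of \<i> "- \<i>"] su(2) u(2)
      by (simp add: fun_eq_iff)
  qed (intro continuous_intros u su)
  obtain b1 b2 where b: "\<And>x. u x + star u x = b1 * e x"
    "\<And>x. \<i> * u x - \<i> * star u x = b2 * e x"
    using 1 2 by auto
  have "u x = ((b1 - \<i> * b2) / 2) * e x" for x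
  proof -
    have "2 * u x = (u x + star u x) - \<i> * (\<i> * u x - \<i> * star u x)"
      by (simp add: algebra_simps)
    also have "\<dots> = (b1 - \<i> * b2) * e x" unfolding b by (simp add: algebra_simps)
    finally show ?thesis by (simp add: mult.commute)
  qed
  then show thesis by (rule that)
qed

text \<open>Every translate of \<open>e\<close> is fixed by \<open>e\<close>, hence a multiple of
  \<open>e\<close> by the corner lemma; so \<open>e / e 0\<close> is multiplicative. Its modulus is
  at most 1 at \<open>x\<close> and at \<open>- x\<close>, and the product of these two values is 1,
  so the modulus is 1 everywhere.\<close>

lemma minimal_idempotent_char:
  assumes e: "idempotent e" and minimal: "\<And>e'. idempotent e' \<Longrightarrow> conv e e' = e' \<Longrightarrow> e' = e"
  obtains \<gamma> where "\<And>x. e x = e 0 * char_fun \<gamma> x"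
proof -
  have e': "continuous_on UNIV e" "conv e e = e"
    using e by (auto simp: idempotent_def)
  have e0: "e 0 \<noteq> 0" "\<And>x. cmod (e x) \<le> cmod (e 0)"
    using idempotent_value_0[OF e] by auto
  have mult: "e (y + x) * e 0 = e x * e y" for x y
  proof -
    let ?u = "\<lambda>y. e (y + x)"
    have u: "continuous_on UNIV ?u" by (rule continuous_translate[OF e'(1)])
    have "conv ?u e = ?u"
    proof
      fix y
      have "conv ?u e y = conv e e (y + x)"
        by (simp add: conv_def algebra_simps)
      then show "conv ?u e y = ?u y" by (simp add: e'(2))
    qed
    then have "conv e ?u = ?u" using conv_commute[OF u e'(1)] by simp
    then obtain c where c: "\<And>y. ?u y = c * e y"
      using minimal_idempotent_corner[OF e minimal u] by metis
    show ?thesis using c[of 0] c[of y] by simp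
  qed
  define f where "f x = e x / e 0" for x
  have f_add: "f (x + y) = f x * f y" for x y
    using mult[of x y] e0(1) by (simp add: f_def field_simps)
  have f_le: "cmod (f x) \<le> 1" for x
    using e0 by (simp add: f_def norm_divide)
  have "f 0 = 1" using e0(1) by (simp add: f_def)
  then have "cmod (f x) * cmod (f (- x)) = 1" for x
    using f_add[of x "- x"] by (simp flip: norm_mult)
  then have f_norm: "cmod (f x) = 1" for x
    using mult_left_mono[OF f_le[of "- x"] norm_ge_zero[of "f x"]] f_le[of x] by force
  have "continuous_on UNIV f"
    unfolding f_def using e0(1) by (intro continuous_intros e') auto
  then obtain \<gamma> where "char_fun \<gamma> = f"
    using ex_char_fun f_norm f_add by metis
  then show thesis using that[of \<gamma>] e0(1) by (simp add: f_def)
qed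

section \<open>Fourier coefficients and their uniqueness\<close>

lemma conv_char_fun: "conv (char_fun \<gamma>) f x = char_fun \<gamma> x * fourier M f \<gamma>"
proof -
  have "conv (char_fun \<gamma>) f x = (LINT y|M. char_fun \<gamma> x * (f y * cnj (char_fun \<gamma> y)))"
    by (simp add: conv_def char_fun_diff mult_ac)
  then show ?thesis by (simp add: fourier_def)
qed

text \<open>A minimal idempotent below the top one of \<open>h = conv f (star f)\<close> is a
  multiple of a character. Vanishing Fourier coefficients make its convolution with
  \<open>f\<close>, hence with \<open>h\<close>, zero, yet \<open>conv h h\<close> multiplies it by
  \<open>l > 0\<close>.\<close>

theorem fourier_eq_zero_imp_zero:
  assumes f: "continuous_on UNIV f" and zero: "\<And>\<gamma>. fourier M f \<gamma> = 0"
  shows "f x = 0"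
proof (rule ccontr)
  assume "f x \<noteq> 0"
  define h where "h = conv f (star f)"
  have sf: "continuous_on UNIV (star f)" by (rule continuous_star[OF f])
  have h: "continuous_on UNIV h" unfolding h_def by (rule continuous_conv[OF f sf])
  have "star h = h"
    unfolding h_def using star_conv[OF f sf] conv_commute[OF f sf] by simp
  moreover have "h 0 \<noteq> 0"
    using conv_star_0[OF f] L2_square_pos[OF f \<open>f x \<noteq> 0\<close>] by (simp add: h_def)
  ultimately obtain e0 l where e0: "idempotent e0" "l > 0"
    "conv (conv h h) e0 = (\<lambda>x. complex_of_real l * e0 x)"
    using top_idempotent[OF h] by metis
  obtain e where e: "idempotent e" "conv e0 e = e"
    and minimal: "\<And>e'. idempotent e' \<Longrightarrow> conv e e' = e' \<Longrightarrow> e' = e"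
    using minimal_idempotent[OF e0(1)] by metis
  obtain \<gamma> where \<gamma>: "\<And>x. e x = e 0 * char_fun \<gamma> x"
    using minimal_idempotent_char[OF e(1) minimal] by metis
  have c: "continuous_on UNIV e0" "continuous_on UNIV e" "continuous_on UNIV (conv h h)"
    using e0(1) e(1) continuous_conv[OF h h] by (auto simp: idempotent_def)
  have "conv e f x = 0" for x
  proof -
    have "conv e f x = conv (\<lambda>x. e 0 * char_fun \<gamma> x) f x"
      by (rule arg_cong[where f = "\<lambda>g. conv g f x"], rule ext, rule \<gamma>)
    then show ?thesis by (simp add: conv_scale conv_char_fun zero)
  qed
  then have "conv e f = (\<lambda>x. 0)" by auto
  then have eh: "conv e h = (\<lambda>x. 0)"
    using conv_assoc[OF c(2) f sf] by (simp add: h_def)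
  have "conv (conv h h) e = (\<lambda>x. 0)"
    using conv_commute[OF c(3,2)] conv_assoc[OF c(2) h h] eh by simp
  \<comment> \<open>\<open>e = conv e0 e\<close> inherits the eigenvalue of
    \<open>e0\<close>.\<close>
  moreover have "conv (conv h h) e x = complex_of_real l * e x" for x
  proof -
    have "conv (conv h h) e = conv (conv (conv h h) e0) e"
      using conv_assoc[OF c(3,1,2)] e(2) by simp
    then show ?thesis by (simp add: e0(3) conv_scale e(2))
  qed
  ultimately have "e x = 0" for x using e0(2) by (simp add: fun_eq_iff)
  then show False using e(1) by (simp add: idempotent_def)
qed

text \<open>Translating by a point \<open>a\<close> where the two characters differ multiplies the
  integral of \<open>\<psi>\<close> by \<open>\<psi> a \<noteq> 1\<close>.\<close>

lemma fourier_char_fun: "fourier M (char_fun \<gamma>) \<delta> = (if \<gamma> = \<delta> then 1 else 0)"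
proof (cases "\<gamma> = \<delta>")
  case True
  then show ?thesis using prob_space by (simp add: fourier_def)
next
  case False
  then obtain a where a: "char_fun \<gamma> a \<noteq> char_fun \<delta> a"
    by (metis char_fun_inject ext)
  define \<psi> where "\<psi> x = char_fun \<gamma> x * cnj (char_fun \<delta> x)" for x
  have "\<psi> a \<noteq> 1"
  proof
    assume "\<psi> a = 1"
    then have "char_fun \<gamma> a * (cnj (char_fun \<delta> a) * char_fun \<delta> a) = char_fun \<delta> a"
      by (simp add: \<psi>_def flip: mult.assoc)
    then show False using a by (simp add: mult.commute[of "cnj _"])
  qed
  have "continuous_on UNIV \<psi>"
    unfolding \<psi>_def by (intro continuous_intros continuous_char_fun)
  then have "(LINT x|M. \<psi> (a + x)) = (LINT x|M. \<psi> x)"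
    by (intro integral_translate continuous_imp_measurable)
  moreover have "\<psi> (a + x) = \<psi> a * \<psi> x" for x
    by (simp add: \<psi>_def char_fun_add mult_ac)
  ultimately have "(LINT x|M. \<psi> x) = 0" using \<open>\<psi> a \<noteq> 1\<close> by simp
  then show ?thesis using False by (simp add: fourier_def \<psi>_def)
qed

lemma continuous_trig_sum: "continuous_on UNIV (\<lambda>x. \<Sum>\<gamma>\<in>S. a \<gamma> * char_fun \<gamma> x)"
  by (intro continuous_intros continuous_char_fun)

lemma fourier_trig_sum:
  assumes "finite S"
  shows "fourier M (\<lambda>x. \<Sum>\<gamma>\<in>S. a \<gamma> * char_fun \<gamma> x) \<delta> = (if \<delta> \<in> S then a \<delta> else 0)"
proof -
  have "fourier M (\<lambda>x. \<Sum>\<gamma>\<in>S. a \<gamma> * char_fun \<gamma> x) \<delta>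
      = (LINT x|M. (\<Sum>\<gamma>\<in>S. a \<gamma> * (char_fun \<gamma> x * cnj (char_fun \<delta> x))))"
    by (simp add: fourier_def sum_distrib_right mult.assoc)
  also have "\<dots> = (\<Sum>\<gamma>\<in>S. LINT x|M. a \<gamma> * (char_fun \<gamma> x * cnj (char_fun \<delta> x)))"
    by (intro Bochner_Integration.integral_sum continuous_imp_integrable continuous_intros
        continuous_char_fun)
  also have "\<dots> = (\<Sum>\<gamma>\<in>S. a \<gamma> * fourier M (char_fun \<gamma>) \<delta>)"
    by (simp add: fourier_def)
  finally show ?thesis using assms by (simp add: fourier_char_fun if_distrib cong: if_cong)
qed

section \<open>The dual of an infinite compact group is infinite\<close>

lemma measure_singleton:
  assumes "infinite (UNIV :: 'a set)"
  shows "measure M {x} = 0"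
proof -
  have sing: "{y} \<in> sets M" for y :: 'a by (simp add: sets_M)
  have same: "measure M {y} = measure M {x}" for y
  proof -
    have "measure M {y} = (LINT z|M. indicator {y} z)" by simp
    also have "\<dots> = (LINT z|M. indicator {y} ((y - x) + z))"
      by (rule integral_translate[symmetric]) (use sing in simp)
    also have "\<dots> = (LINT z|M. indicator {x} z)"
      by (rule Bochner_Integration.integral_cong) (auto simp: indicator_def algebra_simps)
    finally show ?thesis by simp
  qed
  show ?thesis
  proof (rule ccontr)
    assume "measure M {x} \<noteq> 0"
    then have pos: "measure M {x} > 0" using measure_nonneg less_le by metis
    obtain n :: nat where n: "1 < real n * measure M {x}"
      using reals_Archimedean3[OF pos] by blast
    obtain A :: "'a set" where A: "finite A" "card A = n"
      using infinite_arbitrarily_large[OF assms] by blast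
    have "measure M A = (\<Sum>y\<in>A. measure M {y})"
      by (rule finite_measure_eq_sum_singleton) (use A sing in auto)
    also have "\<dots> = (\<Sum>y\<in>A. measure M {x})" by (intro sum.cong refl same)
    also have "\<dots> = real n * measure M {x}" using A by simp
    finally show False using n prob_le_1[of A] by simp
  qed
qed

text \<open>With only \<open>n\<close> characters every continuous function equals its Fourier sum.
  A bump of height 1 at 0, supported in a set of measure below \<open>1 / (n + 1)\<close>, has
  \<open>n\<close> coefficients too small to add up to 1.\<close>

theorem infinite_dual:
  assumes inf: "infinite (UNIV :: 'a set)"
  shows "infinite (UNIV :: 'a dual set)"
proof
  assume fin: "finite (UNIV :: 'a dual set)"
  define n where "n = card (UNIV :: 'a dual set)"
  have expand: "f x = (\<Sum>\<gamma>\<in>UNIV. fourier M f \<gamma> * char_fun \<gamma> x)"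
    if f: "continuous_on UNIV f" for f x
  proof -
    let ?g = "\<lambda>x. \<Sum>\<gamma>\<in>UNIV. fourier M f \<gamma> * char_fun \<gamma> x"
    have g: "continuous_on UNIV ?g" by (rule continuous_trig_sum)
    have "fourier M (\<lambda>x. f x - ?g x) \<delta> = fourier M f \<delta> - fourier M ?g \<delta>" for \<delta>
      unfolding fourier_def left_diff_distrib
      by (intro Bochner_Integration.integral_diff continuous_imp_integrable continuous_on_mult
          continuous_on_cnj continuous_char_fun f g[unfolded fourier_def])
    then have "fourier M (\<lambda>x. f x - ?g x) \<delta> = 0" for \<delta>
      using fourier_trig_sum[OF fin, of "fourier M f" \<delta>] by simp
    then have "f x - ?g x = 0"
      by (rule fourier_eq_zero_imp_zero[OF continuous_on_diff[OF f g]])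
    then show ?thesis by simp
  qed
  define \<epsilon> where "\<epsilon> = 1 / (real n + 1)"
  have \<epsilon>: "\<epsilon> > 0" by (simp add: \<epsilon>_def)
  have "emeasure M {0} = 0"
    using measure_singleton[OF inf, of 0] by (simp add: emeasure_eq_measure)
  \<comment> \<open>Outer regularity at the null set \<open>{0}\<close> provides neighbourhoods of 0
    of arbitrarily small measure.\<close>
  moreover have "\<forall>A\<in>sets borel. emeasure M A = (INF U\<in>{U. open U \<and> A \<subseteq> U}. emeasure M U)"
    using haar unfolding normalized_haar_def by blast
  then have "emeasure M {0} = (INF U\<in>{U. open U \<and> {0} \<subseteq> U}. emeasure M U)"
    by (rule bspec) simp
  ultimately have "(INF U\<in>{U. open U \<and> {0} \<subseteq> U}. emeasure M U) < ennreal \<epsilon>"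
    using \<epsilon> by simp
  then obtain U where U: "open U" "0 \<in> U" "emeasure M U < ennreal \<epsilon>"
    by (auto simp: INF_less_iff)
  then have measure_U: "measure M U < \<epsilon>"
    by (simp add: emeasure_eq_measure ennreal_less_iff)
  have "normal_space (euclidean :: 'a topology)"
    using compact_UNIV by (intro compact_Hausdorff_or_regular_imp_normal_space)
      (simp_all add: compact_space_def Hausdorff_space_def separation_t2 disjnt_def)
  moreover have "closedin euclidean (- U)" "closedin euclidean {0 :: 'a}" "disjnt (- U) {0}"
    using U by (auto simp: disjnt_def)
  ultimately obtain f :: "'a \<Rightarrow> real" where f: "continuous_map euclidean (top_of_set {0..1}) f"
    "f ` (- U) \<subseteq> {0}" "f ` {0} \<subseteq> {1}"
    using Urysohn_lemma[of euclidean "- U" "{0}" 0 1] by auto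
  have f_cont: "continuous_on UNIV f"
    using f(1) by (auto simp: continuous_map_in_subtopology)
  have f_range: "0 \<le> f x" "f x \<le> 1" for x
    using f(1) by (auto simp: continuous_map_in_subtopology)
  let ?f = "\<lambda>x. complex_of_real (f x)"
  have fc: "continuous_on UNIV ?f" by (intro continuous_intros f_cont)
  have four: "cmod (fourier M ?f \<gamma>) \<le> measure M U" for \<gamma>
  proof -
    have "cmod (fourier M ?f \<gamma>) \<le> (LINT x|M. cmod (?f x * cnj (char_fun \<gamma> x)))"
      unfolding fourier_def by (rule integral_norm_bound)
    also have "\<dots> \<le> (LINT x|M. indicator U x)"
    proof (rule integral_mono)
      show "integrable M (\<lambda>x. cmod (?f x * cnj (char_fun \<gamma> x)))"
        using continuous_imp_integrable_norm[OF fc, of 1] by (simp add: norm_mult)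
      show "integrable M (indicator U :: 'a \<Rightarrow> real)"
        using U(1) by (simp add: sets_M emeasure_eq_measure)
      show "cmod (?f x * cnj (char_fun \<gamma> x)) \<le> indicator U x" for x
        using f(2) f_range[of x] by (auto simp: norm_mult indicator_def)
    qed
    finally show ?thesis by simp
  qed
  have "1 = cmod (?f 0)" using f(3) by simp
  also have "?f 0 = (\<Sum>\<gamma>\<in>UNIV. fourier M ?f \<gamma> * char_fun \<gamma> 0)" by (rule expand[OF fc])
  also have "cmod \<dots> \<le> (\<Sum>\<gamma>\<in>(UNIV :: 'a dual set). measure M U)"
    by (rule sum_norm_le) (simp add: four)
  also have "\<dots> = real n * measure M U" by (simp add: n_def)
  also have "\<dots> \<le> real n * \<epsilon>" using measure_U by (intro mult_left_mono) auto
  also have "\<dots> < 1" by (simp add: \<epsilon>_def field_simps)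
  finally show False by simp
qed

end

section \<open>Rudin--Shapiro polynomials and the triviality estimate\<close>

text \<open>Multiplication in the dual group, seen as a shift of spectra by
  \<open>\<delta>\<close>.\<close>

definition twist :: "'a::topological_ab_group_add dual \<Rightarrow> 'a dual \<Rightarrow> 'a dual" where
  "twist \<delta> \<gamma> = Abs_dual (\<lambda>x. char_fun \<delta> x * char_fun \<gamma> x)"

lemma char_fun_twist: "char_fun (twist \<delta> \<gamma>) x = char_fun \<delta> x * char_fun \<gamma> x"
  unfolding twist_def
  by (subst Abs_dual_inverse)
    (auto simp: norm_mult char_fun_add mult_ac intro!: continuous_intros continuous_char_fun)

text \<open>Injectivity in \<open>\<gamma>\<close> makes a shifted spectrum a bijective copy;
  injectivity in \<open>\<delta>\<close> leaves only finitely many shifts for which a finite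
  spectrum meets its copy.\<close>

lemma inj_twist:
  fixes \<gamma> \<delta> :: "'a::topological_ab_group_add dual"
  shows "inj (twist \<delta>)" "inj (\<lambda>\<delta>. twist \<delta> \<gamma>)"
proof -
  have "\<gamma> = \<gamma>'" if "twist \<delta> \<gamma> = twist \<delta> \<gamma>'" for \<gamma> \<gamma>' :: "'a dual"
  proof -
    have "char_fun (twist \<delta> \<gamma>) x = char_fun (twist \<delta> \<gamma>') x" for x using that by simp
    then show ?thesis by (simp add: char_fun_twist fun_eq_iff flip: char_fun_inject)
  qed
  then show "inj (twist \<delta>)" by (rule injI)
  have "\<delta> = \<delta>'" if "twist \<delta> \<gamma> = twist \<delta>' \<gamma>" for \<delta> \<delta>' :: "'a dual"
  proof -
    have "char_fun (twist \<delta> \<gamma>) x = char_fun (twist \<delta>' \<gamma>) x" for x using that by simp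
    then show ?thesis by (simp add: char_fun_twist fun_eq_iff flip: char_fun_inject)
  qed
  then show "inj (\<lambda>\<delta>. twist \<delta> \<gamma>)" by (rule injI)
qed

lemma parallelogram: "(cmod (p + q))\<^sup>2 + (cmod (p - q))\<^sup>2 = 2 * (cmod p)\<^sup>2 + 2 * (cmod q)\<^sup>2"
  unfolding cmod_power2 by (simp add: power2_eq_square algebra_simps)

text \<open>Pass from \<open>(P, Q)\<close> to \<open>(P + \<delta> Q, P - \<delta> Q)\<close>, with \<open>\<delta>\<close> chosen so that
  the spectra of \<open>P\<close> and \<open>\<delta> Q\<close> are disjoint.\<close>

lemma Rudin_Shapiro_pair:
  assumes inf: "infinite (UNIV :: 'a::topological_ab_group_add dual set)"
  shows "\<exists>(S :: 'a dual set) a b. finite S \<and> card S = 2 ^ k \<and>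
    (\<forall>\<gamma>\<in>S. cmod (a \<gamma>) = 1 \<and> cmod (b \<gamma>) = 1) \<and>
    (\<forall>x. (cmod (\<Sum>\<gamma>\<in>S. a \<gamma> * char_fun \<gamma> x))\<^sup>2 + (cmod (\<Sum>\<gamma>\<in>S. b \<gamma> * char_fun \<gamma> x))\<^sup>2 = 2 ^ (k + 1))"
proof (induction k)
  case 0
  show ?case
    by (rule exI[of _ "{undefined}"], rule exI[of _ "\<lambda>_. 1"], rule exI[of _ "\<lambda>_. 1"]) simp
next
  case (Suc k)
  then obtain S :: "'a dual set" and a b where S: "finite S" "card S = 2 ^ k"
    and ab: "\<And>\<gamma>. \<gamma> \<in> S \<Longrightarrow> cmod (a \<gamma>) = 1" "\<And>\<gamma>. \<gamma> \<in> S \<Longrightarrow> cmod (b \<gamma>) = 1"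
    and PQ: "\<And>x. (cmod (\<Sum>\<gamma>\<in>S. a \<gamma> * char_fun \<gamma> x))\<^sup>2 + (cmod (\<Sum>\<gamma>\<in>S. b \<gamma> * char_fun \<gamma> x))\<^sup>2 = 2 ^ (k + 1)"
    by blast
  have "finite (\<Union>\<gamma>\<in>S. (\<lambda>\<delta>. twist \<delta> \<gamma>) -` S)"
    using S(1) by (intro finite_UN_I finite_vimageI inj_twist)
  then obtain \<delta> where \<delta>: "\<delta> \<notin> (\<Union>\<gamma>\<in>S. (\<lambda>\<delta>. twist \<delta> \<gamma>) -` S)"
    using ex_new_if_finite[OF inf] by blast
  have disj: "S \<inter> twist \<delta> ` S = {}" using \<delta> by auto
  define T where "T = S \<union> twist \<delta> ` S"
  define b' where "b' = (\<lambda>\<gamma>. b (inv (twist \<delta>) \<gamma>))"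
  have b': "b' (twist \<delta> \<gamma>) = b \<gamma>" for \<gamma> by (simp add: b'_def inj_twist)
  define P Q where "P x = (\<Sum>\<gamma>\<in>S. a \<gamma> * char_fun \<gamma> x)" and "Q x = (\<Sum>\<gamma>\<in>S. b \<gamma> * char_fun \<gamma> x)" for x
  \<comment> \<open>The sign \<open>c\<close> stays a parameter so that one computation serves both
    members of the new pair.\<close>
  have sum_T: "(\<Sum>\<gamma>\<in>T. (if \<gamma> \<in> S then a \<gamma> else c * b' \<gamma>) * char_fun \<gamma> x) = P x + c * (char_fun \<delta> x * Q x)"
    for c x
  proof -
    have "(\<Sum>\<gamma>\<in>T. (if \<gamma> \<in> S then a \<gamma> else c * b' \<gamma>) * char_fun \<gamma> x)
        = (\<Sum>\<gamma>\<in>S. (if \<gamma> \<in> S then a \<gamma> else c * b' \<gamma>) * char_fun \<gamma> x)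
          + (\<Sum>\<gamma>\<in>twist \<delta> ` S. (if \<gamma> \<in> S then a \<gamma> else c * b' \<gamma>) * char_fun \<gamma> x)"
      unfolding T_def using S(1) disj by (intro sum.union_disjoint) auto
    also have "(\<Sum>\<gamma>\<in>S. (if \<gamma> \<in> S then a \<gamma> else c * b' \<gamma>) * char_fun \<gamma> x) = P x"
      unfolding P_def by (intro sum.cong) auto
    also have "(\<Sum>\<gamma>\<in>twist \<delta> ` S. (if \<gamma> \<in> S then a \<gamma> else c * b' \<gamma>) * char_fun \<gamma> x)
        = (\<Sum>\<gamma>\<in>twist \<delta> ` S. c * b' \<gamma> * char_fun \<gamma> x)"
      using disj by (intro sum.cong) auto
    also have "\<dots> = (\<Sum>\<gamma>\<in>S. c * b' (twist \<delta> \<gamma>) * char_fun (twist \<delta> \<gamma>) x)"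
      by (rule sum.reindex_cong[OF inj_on_subset[OF inj_twist(1)]]) auto
    also have "\<dots> = c * (char_fun \<delta> x * Q x)"
      by (simp add: b' char_fun_twist Q_def sum_distrib_left mult_ac)
    finally show ?thesis .
  qed
  have PQ': "(cmod (P x + 1 * (char_fun \<delta> x * Q x)))\<^sup>2 + (cmod (P x + (- 1) * (char_fun \<delta> x * Q x)))\<^sup>2
      = 2 ^ (Suc k + 1)" for x
    using parallelogram[of "P x" "char_fun \<delta> x * Q x"] PQ[of x]
    by (simp add: P_def Q_def norm_mult)
  have norm: "cmod (if \<gamma> \<in> S then a \<gamma> else c * b' \<gamma>) = 1" if "\<gamma> \<in> T" "cmod c = 1" for \<gamma> c
    using that ab b' by (auto simp: T_def norm_mult)
  have "finite T" "card T = 2 ^ Suc k"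
    unfolding T_def using S disj card_image[OF inj_on_subset[OF inj_twist(1) subset_UNIV], of \<delta> S]
    by (auto simp: card_Un_disjoint)
  moreover have "\<forall>\<gamma>\<in>T. cmod (if \<gamma> \<in> S then a \<gamma> else 1 * b' \<gamma>) = 1
      \<and> cmod (if \<gamma> \<in> S then a \<gamma> else (- 1) * b' \<gamma>) = 1"
    using norm[of _ 1] norm[of _ "- 1"] by simp
  moreover have "\<forall>x. (cmod (\<Sum>\<gamma>\<in>T. (if \<gamma> \<in> S then a \<gamma> else 1 * b' \<gamma>) * char_fun \<gamma> x))\<^sup>2
      + (cmod (\<Sum>\<gamma>\<in>T. (if \<gamma> \<in> S then a \<gamma> else (- 1) * b' \<gamma>) * char_fun \<gamma> x))\<^sup>2 = 2 ^ (Suc k + 1)"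
    unfolding sum_T using PQ' by blast
  ultimately show ?case
    by (intro exI[of _ T] exI[of _ "\<lambda>\<gamma>. if \<gamma> \<in> S then a \<gamma> else 1 * b' \<gamma>"]
        exI[of _ "\<lambda>\<gamma>. if \<gamma> \<in> S then a \<gamma> else (- 1) * b' \<gamma>"] conjI)
qed

text \<open>These polynomials are flat: the mean of the squared modulus is \<open>2 ^ k\<close>, and
  its supremum is at most twice that.\<close>

lemma Rudin_Shapiro:
  assumes "infinite (UNIV :: 'a::topological_ab_group_add dual set)"
  obtains S :: "'a::topological_ab_group_add dual set" and a
  where "finite S" "card S = 2 ^ k" "\<And>\<gamma>. \<gamma> \<in> S \<Longrightarrow> cmod (a \<gamma>) = 1"
    "\<And>x. (cmod (\<Sum>\<gamma>\<in>S. a \<gamma> * char_fun \<gamma> x))\<^sup>2 \<le> 2 ^ (k + 1)"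
proof -
  obtain S :: "'a dual set" and a b where S: "finite S" "card S = 2 ^ k"
    "\<And>\<gamma>. \<gamma> \<in> S \<Longrightarrow> cmod (a \<gamma>) = 1"
    and eq: "\<And>x. (cmod (\<Sum>\<gamma>\<in>S. a \<gamma> * char_fun \<gamma> x))\<^sup>2 + (cmod (\<Sum>\<gamma>\<in>S. b \<gamma> * char_fun \<gamma> x))\<^sup>2 = 2 ^ (k + 1)"
    using Rudin_Shapiro_pair[OF assms, of k] by blast
  have "(cmod (\<Sum>\<gamma>\<in>S. a \<gamma> * char_fun \<gamma> x))\<^sup>2 \<le> 2 ^ (k + 1)" for x
    using eq[of x] by (smt (verit) zero_le_power2)
  then show thesis using that S by blast
qed

section \<open>L_p estimates on a probability space\<close>

lemma powr_le_one_plus_powr: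
  fixes t :: real
  assumes "0 \<le> t" "0 \<le> r" "r \<le> s"
  shows "t powr r \<le> 1 + t powr s"
proof (cases "t \<le> 1")
  case True
  then have "t powr r \<le> 1" using assms by (simp add: powr_le1)
  then show ?thesis using powr_ge_zero[of t s] by linarith
next
  case False
  then have "t powr r \<le> t powr s" using assms by (intro powr_mono) auto
  then show ?thesis by linarith
qed

text \<open>A crude form of the triangle inequality, enough to show that differences stay in
  L_q.\<close>

lemma powr_add_le:
  fixes s t :: real
  assumes "0 \<le> s" "0 \<le> t" "0 \<le> r"
  shows "(s + t) powr r \<le> 2 powr r * (s powr r + t powr r)"
proof -
  have "(s + t) powr r \<le> (2 * max s t) powr r"
    using assms by (intro powr_mono2) auto
  also have "\<dots> = 2 powr r * max s t powr r"
    using assms by (simp add: powr_mult)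
  also have "\<dots> \<le> 2 powr r * (s powr r + t powr r)"
    by (intro mult_left_mono) (auto simp: max_def)
  finally show ?thesis .
qed

context prob_space
begin

lemma integrable_powr_mono:
  fixes g :: "'a \<Rightarrow> complex"
  assumes g: "g \<in> borel_measurable M" and int: "integrable M (\<lambda>x. cmod (g x) powr s)"
    and "0 \<le> r" "r \<le> s"
  shows "integrable M (\<lambda>x. cmod (g x) powr r)"
proof (rule Bochner_Integration.integrable_bound)
  show "integrable M (\<lambda>x. 1 + cmod (g x) powr s)" using int by simp
  show "AE x in M. norm (cmod (g x) powr r) \<le> norm (1 + cmod (g x) powr s)"
  proof (rule AE_I2)
    fix x
    have "cmod (g x) powr r \<le> 1 + cmod (g x) powr s"
      using assms by (intro powr_le_one_plus_powr) auto
    then show "norm (cmod (g x) powr r) \<le> norm (1 + cmod (g x) powr s)" by simp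
  qed
qed (use g in measurable)

text \<open>For \<open>q \<le> 2\<close> the essential supremum branch is excluded, which leaves a
  real exponent.\<close>

lemma Lp_space_cases:
  assumes q: "1 \<le> q" "q \<le> (2 :: ereal)"
  obtains r where "1 \<le> r" "r \<le> 2"
    "\<And>g. g \<in> Lp_space M q \<longleftrightarrow> g \<in> borel_measurable M \<and> integrable M (\<lambda>x. cmod (g x) powr r)"
    "\<And>g. Lp_norm M q g = (LINT x|M. cmod (g x) powr r) powr (1 / r)"
proof -
  obtain r where r: "q = ereal r" using q by (cases q) auto
  show thesis
    by (rule that[of r]) (use q r in \<open>auto simp: Lp_space_def Lp_norm_def one_ereal_def numeral_eq_ereal\<close>)
qed

lemma Lp_space_2_subset:
  assumes q: "1 \<le> q" "q \<le> (2 :: ereal)" and g: "g \<in> Lp_space M 2"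
  shows "g \<in> Lp_space M q"
proof -
  obtain r where r: "1 \<le> r" "r \<le> 2"
    "\<And>g. g \<in> Lp_space M q \<longleftrightarrow> g \<in> borel_measurable M \<and> integrable M (\<lambda>x. cmod (g x) powr r)"
    using Lp_space_cases[OF q] by metis
  have "g \<in> borel_measurable M" "integrable M (\<lambda>x. cmod (g x) powr 2)"
    using g by (auto simp: Lp_space_def)
  then show ?thesis using r integrable_powr_mono[of g 2 r] by auto
qed

lemma Lp_space_integrable:
  assumes q: "1 \<le> q" "q \<le> (2 :: ereal)" and g: "g \<in> Lp_space M q"
  shows "integrable M g"
proof -
  obtain r where r: "1 \<le> r" "r \<le> 2"
    "\<And>g. g \<in> Lp_space M q \<longleftrightarrow> g \<in> borel_measurable M \<and> integrable M (\<lambda>x. cmod (g x) powr r)"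
    using Lp_space_cases[OF q] by metis
  have g: "g \<in> borel_measurable M" "integrable M (\<lambda>x. cmod (g x) powr r)"
    using g r(3) by auto
  have "integrable M (\<lambda>x. cmod (g x))"
    using integrable_powr_mono[OF g(1,2), of 1] r(1) by simp
  then show ?thesis using g(1) by (simp add: integrable_norm_iff)
qed

lemma Lp_space_diff:
  assumes q: "1 \<le> q" "q \<le> (2 :: ereal)" and f: "f \<in> Lp_space M q" and g: "g \<in> Lp_space M q"
  shows "(\<lambda>x. f x - g x) \<in> Lp_space M q"
proof -
  obtain r where r: "1 \<le> r" "r \<le> 2"
    "\<And>g. g \<in> Lp_space M q \<longleftrightarrow> g \<in> borel_measurable M \<and> integrable M (\<lambda>x. cmod (g x) powr r)"
    using Lp_space_cases[OF q] by metis
  have f: "f \<in> borel_measurable M" "integrable M (\<lambda>x. cmod (f x) powr r)"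
    and g: "g \<in> borel_measurable M" "integrable M (\<lambda>x. cmod (g x) powr r)"
    using f g r(3) by auto
  have "integrable M (\<lambda>x. cmod (f x - g x) powr r)"
  proof (rule Bochner_Integration.integrable_bound)
    show "integrable M (\<lambda>x. 2 powr r * (cmod (f x) powr r + cmod (g x) powr r))"
      using f(2) g(2) by simp
    show "AE x in M. norm (cmod (f x - g x) powr r)
        \<le> norm (2 powr r * (cmod (f x) powr r + cmod (g x) powr r))"
    proof (rule AE_I2)
      fix x
      have "cmod (f x - g x) powr r \<le> (cmod (f x) + cmod (g x)) powr r"
        using r(1) by (intro powr_mono2 norm_triangle_ineq4) auto
      also have "\<dots> \<le> 2 powr r * (cmod (f x) powr r + cmod (g x) powr r)"
        using r(1) by (intro powr_add_le) auto
      finally show "norm (cmod (f x - g x) powr r)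
        \<le> norm (2 powr r * (cmod (f x) powr r + cmod (g x) powr r))" by simp
    qed
  qed (use f g in measurable)
  then show ?thesis using r(3) f(1) g(1) by simp
qed

text \<open>The sharp constant is 1; the factor 2 comes from integrating the pointwise bound
  \<open>le\<close>, whose two summands each contribute \<open>A\<close>. The value of the constant
  does not affect triviality.\<close>

lemma integral_norm_le_Lp_norm:
  assumes q: "1 \<le> q" "q \<le> (2 :: ereal)" and g: "g \<in> Lp_space M q"
  shows "(LINT x|M. cmod (g x)) \<le> 2 * Lp_norm M q g"
proof -
  obtain r where r: "1 \<le> r" "r \<le> 2"
    "\<And>g. g \<in> Lp_space M q \<longleftrightarrow> g \<in> borel_measurable M \<and> integrable M (\<lambda>x. cmod (g x) powr r)"
    "\<And>g. Lp_norm M q g = (LINT x|M. cmod (g x) powr r) powr (1 / r)"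
    using Lp_space_cases[OF q] by metis
  define I A where "I = (LINT x|M. cmod (g x) powr r)" and "A = I powr (1 / r)"
  have int: "integrable M (\<lambda>x. cmod (g x) powr r)" using g r(3) by simp
  have int1: "integrable M (\<lambda>x. cmod (g x))"
    using Lp_space_integrable[OF q g] by simp
  have I: "I \<ge> 0" by (simp add: I_def)
  show ?thesis
  proof (cases "I = 0")
    case True
    then have "AE x in M. cmod (g x) powr r = 0"
      using int unfolding I_def by (subst (asm) integral_nonneg_eq_0_iff_AE) auto
    then have "AE x in M. cmod (g x) = 0" by eventually_elim simp
    then have "(LINT x|M. cmod (g x)) = 0" by (rule integral_eq_zero_AE)
    then show ?thesis by (simp add: r(4))
  next
    case False
    then have A: "A > 0" "A powr r = I" using I r(1) by (auto simp: A_def powr_powr)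
    have le: "t \<le> A + A / I * t powr r" if t: "0 \<le> t" for t
    proof (cases "t \<le> A")
      case True
      have "0 \<le> A / I * t powr r" using A I by simp
      then show ?thesis using True by linarith
    next
      case False
      then have "1 \<le> t / A" using A by simp
      then have "(t / A) powr 1 \<le> (t / A) powr r" using r(1) by (intro powr_mono) auto
      also have "\<dots> = t powr r / I" using A t by (simp add: powr_divide)
      finally have "t / A \<le> t powr r / I" using A(1) t by simp
      then have "t \<le> A / I * t powr r" using A(1) by (simp add: field_simps)
      then show ?thesis using A by simp
    qed
    have "(LINT x|M. cmod (g x)) \<le> (LINT x|M. A + A / I * cmod (g x) powr r)"
      using int int1 le by (intro integral_mono) auto
    also have "\<dots> = A + A / I * I" using int prob_space by (simp add: I_def)
    also have "\<dots> = 2 * A" using False by simp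
    finally show ?thesis by (simp add: r(4) A_def I_def)
  qed
qed

text \<open>Together with \<open>sup_norm_le_bound\<close> this lets \<open>not_trivial\<close>
  treat all source norms at once, through their domination by uniform bounds.\<close>

lemma Lp_norm_le_bound:
  assumes f: "f \<in> borel_measurable M" and B: "\<And>x. cmod (f x) \<le> B" and p: "2 \<le> p"
  shows "\<bar>Lp_norm M p f\<bar> \<le> B"
proof (cases "p = \<infinity>")
  case True
  let ?g = "\<lambda>x. ereal (cmod (f x))"
  have meas: "?g \<in> borel_measurable M" using f by measurable
  have "esssup M ?g \<le> ereal B" by (rule esssup_I[OF meas]) (simp add: B)
  moreover have "0 \<le> esssup M ?g"
  proof -
    have "esssup M (\<lambda>x. 0 :: ereal) = 0"
      by (rule esssup_const) (simp add: emeasure_space_1)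
    moreover have "esssup M (\<lambda>x. 0 :: ereal) \<le> esssup M ?g"
      by (rule esssup_mono) auto
    ultimately show ?thesis by simp
  qed
  ultimately show ?thesis using True by (cases "esssup M ?g") (auto simp: Lp_norm_def)
next
  case False
  then obtain r where r: "p = ereal r" using p by (cases p) auto
  then have r2: "r \<ge> 2" using p by (simp add: numeral_eq_ereal)
  have B0: "B \<ge> 0" using B[of undefined] norm_ge_zero order_trans by blast
  have "(LINT x|M. cmod (f x) powr r) \<le> (LINT x|M. B powr r)"
  proof (rule integral_mono)
    show le: "cmod (f x) powr r \<le> B powr r" for x
      using r2 B by (intro powr_mono2) auto
    show "integrable M (\<lambda>x. cmod (f x) powr r)"
      by (rule integrable_const_bound[of _ "B powr r"]) (use le f in auto)
  qed simp
  then have "(LINT x|M. cmod (f x) powr r) powr (1 / r) \<le> (B powr r) powr (1 / r)"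
    using r2 prob_space by (intro powr_mono2) auto
  also have "\<dots> = B" using B0 r2 by (simp add: powr_powr)
  finally show ?thesis using False r by (simp add: Lp_norm_def)
qed

end

lemma sup_norm_le_bound:
  assumes "\<And>x. cmod (f x) \<le> B"
  shows "\<bar>sup_norm f\<bar> \<le> B"
proof -
  have "sup_norm f \<le> B"
    unfolding sup_norm_def by (rule cSUP_least) (use assms in auto)
  moreover have "cmod (f undefined) \<le> sup_norm f"
    unfolding sup_norm_def by (rule cSUP_upper) (use assms in \<open>auto intro!: bdd_aboveI[of _ B]\<close>)
  then have "0 \<le> sup_norm f" using norm_ge_zero order_trans by blast
  ultimately show ?thesis by simp
qed

lemma trig_sum_polynomial:
  "finite S \<Longrightarrow> (\<lambda>x. \<Sum>\<gamma>\<in>S. a \<gamma> * char_fun \<gamma> x) \<in> polynomials"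
  unfolding polynomials_def by blast

lemma char_fun_polynomial: "char_fun \<gamma> \<in> polynomials"
  using trig_sum_polynomial[of "{\<gamma>}" "\<lambda>_. 1"] by simp

text \<open>All nonzero coefficients have the same modulus, so the logarithm takes a single value
  and the map acts as a scalar that depends only on \<open>card S\<close>.\<close>

lemma kalton_peck_unimodular:
  assumes "finite S" and c: "\<And>i. i \<in> S \<Longrightarrow> cmod (c i) = 1"
  shows "kalton_peck \<phi> (\<lambda>i. if i \<in> S then c i else 0)
    = (\<lambda>i. if i \<in> S then c i * complex_of_real (\<phi> (ln (sqrt (card S)))) else 0)"
proof -
  let ?c = "\<lambda>i. if i \<in> S then c i else 0"
  have "(\<Sum>\<^sub>\<infinity>i. (cmod (?c i))\<^sup>2) = (\<Sum>\<^sub>\<infinity>i\<in>S. 1)"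
    by (rule infsum_cong_neutral) (auto simp: c)
  then have "l2_norm ?c = sqrt (card S)"
    using assms(1) by (simp add: l2_norm_def)
  then show ?thesis
    using c by (fastforce simp: kalton_peck_def fun_eq_iff)
qed

section \<open>Averaging over translations and the contradiction\<close>

context compact_haar_group
begin

text \<open>Averaging \<open>L\<close> over translations would turn it into a Fourier multiplier with symbol
  \<open>\<gamma> \<mapsto> fourier M (L \<gamma>) \<gamma>\<close>. Pairing with the translates of a fixed polynomial makes the
  average an integral of a trigonometric polynomial in the translation parameter.\<close>

lemma multiplier_bound:
  assumes q: "1 \<le> q" "q \<le> (2 :: ereal)"
    and N: "\<forall>f\<in>polynomials. \<forall>B. (\<forall>x. cmod (f x) \<le> B) \<longrightarrow> \<bar>N f\<bar> \<le> B"
    and trivial: "trivial_into_Lq polynomials N M q (mho M \<phi>)"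
  shows "\<exists>(A :: 'a dual \<Rightarrow> complex) K. \<forall>S a B. finite S \<longrightarrow> (\<forall>\<gamma>\<in>S. cmod (a \<gamma>) = 1) \<longrightarrow>
    (\<forall>x. cmod (\<Sum>\<gamma>\<in>S. a \<gamma> * char_fun \<gamma> x) \<le> B) \<longrightarrow>
    cmod (\<Sum>\<gamma>\<in>S. complex_of_real (\<phi> (ln (sqrt (card S)))) - A \<gamma>) \<le> K * B\<^sup>2"
proof -
  obtain L K where L_Lq: "\<And>f. f \<in> polynomials \<Longrightarrow> L f \<in> Lp_space M q"
    and L_add: "\<And>f g. f \<in> polynomials \<Longrightarrow> g \<in> polynomials \<Longrightarrow> AE x in M. L (\<lambda>y. f y + g y) x = L f x + L g x"
    and L_scale: "\<And>c f. f \<in> polynomials \<Longrightarrow> AE x in M. L (\<lambda>y. c * f y) x = c * L f x"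
    and L_bound: "\<And>f. f \<in> polynomials \<Longrightarrow> Lp_norm M q (\<lambda>x. mho M \<phi> f x - L f x) \<le> K * N f"
    using trivial unfolding trivial_into_Lq_def by blast
  have L_sum: "AE x in M. L (\<lambda>y. \<Sum>\<gamma>\<in>S. c \<gamma> * char_fun \<gamma> y) x = (\<Sum>\<gamma>\<in>S. c \<gamma> * L (char_fun \<gamma>) x)"
    if "finite S" for S c
    using that
  proof (induction S)
    \<comment> \<open>The zero polynomial is 0 times a character, so homogeneity settles this
      case.\<close>
    case empty
    show ?case using L_scale[OF char_fun_polynomial, of 0] by simp
  next
    case (insert \<gamma> S)
    have "(\<lambda>y. c \<gamma> * char_fun \<gamma> y) \<in> polynomials"
      using trig_sum_polynomial[of "{\<gamma>}" c] by simp
    from L_add[OF this trig_sum_polynomial[OF insert(1), of c]]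
    show ?case
      using insert(3) L_scale[OF char_fun_polynomial, of "c \<gamma>" \<gamma>] insert(1,2)
      by (auto elim!: eventually_elim2 simp: eventually_conj_iff)
  qed
  define A where "A \<gamma> = fourier M (L (char_fun \<gamma>)) \<gamma>" for \<gamma>
  have "cmod (\<Sum>\<gamma>\<in>S. complex_of_real (\<phi> (ln (sqrt (card S)))) - A \<gamma>) \<le> 2 * \<bar>K\<bar> * B\<^sup>2"
    if S: "finite S" and a: "\<And>\<gamma>. \<gamma> \<in> S \<Longrightarrow> cmod (a \<gamma>) = 1"
      and B: "\<And>x. cmod (\<Sum>\<gamma>\<in>S. a \<gamma> * char_fun \<gamma> x) \<le> B" for S a B
  proof -
    define w where "w = complex_of_real (\<phi> (ln (sqrt (card S))))"
    \<comment> \<open>The matrix of \<open>L\<close> with respect to the characters; its diagonal is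
      \<open>A\<close>, and averaging over \<open>t\<close> will remove all other entries.\<close>
    define l where "l \<gamma>' \<gamma> = fourier M (L (char_fun \<gamma>')) \<gamma>" for \<gamma>' \<gamma>
    \<comment> \<open>The coefficients of the translate by \<open>t\<close>. They stay unimodular on
      \<open>S\<close>, so the Kalton--Peck map multiplies them by the same \<open>w\<close> for
      every \<open>t\<close>.\<close>
    define c where "c t \<gamma> = a \<gamma> * char_fun \<gamma> t" for t \<gamma>
    define f where "f t x = (\<Sum>\<gamma>\<in>S. c t \<gamma> * char_fun \<gamma> x)" for t x
    define g where "g t x = mho M \<phi> (f t) x - L (f t) x" for t x
    define E where "E t = (LINT x|M. g t x * cnj (f t x))" for t
    have f_poly: "f t \<in> polynomials" for t
      unfolding f_def by (rule trig_sum_polynomial[OF S])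
    have f_cont: "continuous_on UNIV (f t)" for t
      unfolding f_def by (rule continuous_trig_sum)
    have f_le: "cmod (f t x) \<le> B" for t x
      using B[of "t + x"] by (simp add: f_def c_def char_fun_add mult.assoc)
    have B0: "B \<ge> 0" using f_le[of 0 0] norm_ge_zero order_trans by blast
    have c_norm: "cmod (c t \<gamma>) = 1" if "\<gamma> \<in> S" for t \<gamma>
      using a[OF that] by (simp add: c_def norm_mult)
    have four_f: "fourier M (f t) = (\<lambda>\<gamma>. if \<gamma> \<in> S then c t \<gamma> else 0)" for t
      unfolding f_def by (rule ext) (rule fourier_trig_sum[OF S])
    have omega: "kalton_peck \<phi> (fourier M (f t)) = (\<lambda>\<gamma>. if \<gamma> \<in> S then c t \<gamma> * w else 0)" for t
      unfolding four_f w_def by (rule kalton_peck_unimodular[OF S c_norm])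
    \<comment> \<open>\<open>fourier_inv\<close> is a choice of preimage, so its value is meaningful
      only once a preimage is exhibited. Afterwards \<open>mho\<close> is known through its Fourier
      coefficients alone.\<close>
    have in_range: "kalton_peck \<phi> (fourier M (f t)) \<in> fourier M ` Lp_space M 2" for t
    proof (rule image_eqI)
      let ?h = "\<lambda>x. \<Sum>\<gamma>\<in>S. (c t \<gamma> * w) * char_fun \<gamma> x"
      show "kalton_peck \<phi> (fourier M (f t)) = fourier M ?h"
        unfolding omega by (rule ext) (rule fourier_trig_sum[OF S, symmetric])
      have h: "continuous_on UNIV ?h" by (rule continuous_trig_sum)
      show "?h \<in> Lp_space M 2"
        using continuous_imp_integrable_norm[OF h, of 2] continuous_imp_measurable[OF h]
        by (simp add: Lp_space_def)
    qed
    have mho_L2: "mho M \<phi> (f t) \<in> Lp_space M 2" for t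
      unfolding mho_def fourier_inv_def by (rule inv_into_into[OF in_range])
    have four_mho: "fourier M (mho M \<phi> (f t)) = (\<lambda>\<gamma>. if \<gamma> \<in> S then c t \<gamma> * w else 0)" for t
      using f_inv_into_f[OF in_range[of t]] omega by (simp add: mho_def fourier_inv_def)
    have mho_int: "integrable M (mho M \<phi> (f t))" for t
      by (rule Lp_space_integrable[OF _ _ mho_L2]) auto
    have L_int: "integrable M (L h)" if "h \<in> polynomials" for h
      by (rule Lp_space_integrable[OF q L_Lq[OF that]])
    have times_char: "integrable M (\<lambda>x. h x * cnj (char_fun \<gamma> x))" if h: "integrable M h" for h \<gamma>
    proof (rule Bochner_Integration.integrable_bound[OF h])
      show "(\<lambda>x. h x * cnj (char_fun \<gamma> x)) \<in> borel_measurable M"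
        by (rule borel_measurable_times[OF borel_measurable_integrable[OF h] continuous_imp_measurable])
          (intro continuous_intros continuous_char_fun)
    qed (simp add: norm_mult)
    have g_Lq: "g t \<in> Lp_space M q" for t
      unfolding g_def
      by (intro Lp_space_diff[OF q] L_Lq f_poly Lp_space_2_subset[OF q] mho_L2)
    have g_int: "integrable M (g t)" for t
      by (rule Lp_space_integrable[OF q g_Lq])
    have four_L: "fourier M (L (f t)) \<gamma> = (\<Sum>\<gamma>'\<in>S. c t \<gamma>' * l \<gamma>' \<gamma>)" for t \<gamma>
    proof -
      have "fourier M (L (f t)) \<gamma> = (LINT x|M. (\<Sum>\<gamma>'\<in>S. c t \<gamma>' * L (char_fun \<gamma>') x) * cnj (char_fun \<gamma> x))"
        unfolding fourier_def
      proof (rule integral_cong_AE)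
        show "AE x in M. L (f t) x * cnj (char_fun \<gamma> x)
            = (\<Sum>\<gamma>'\<in>S. c t \<gamma>' * L (char_fun \<gamma>') x) * cnj (char_fun \<gamma> x)"
          using L_sum[OF S, of "c t"] unfolding f_def by eventually_elim simp
        show "(\<lambda>x. L (f t) x * cnj (char_fun \<gamma> x)) \<in> borel_measurable M"
          using times_char[OF L_int[OF f_poly]] by auto
        have "integrable M (\<lambda>x. \<Sum>\<gamma>'\<in>S. c t \<gamma>' * L (char_fun \<gamma>') x)"
          by (intro Bochner_Integration.integrable_sum integrable_mult_right L_int char_fun_polynomial)
        from times_char[OF this]
        show "(\<lambda>x. (\<Sum>\<gamma>'\<in>S. c t \<gamma>' * L (char_fun \<gamma>') x) * cnj (char_fun \<gamma> x)) \<in> borel_measurable M"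
          by auto
      qed
      also have "\<dots> = (LINT x|M. (\<Sum>\<gamma>'\<in>S. c t \<gamma>' * (L (char_fun \<gamma>') x * cnj (char_fun \<gamma> x))))"
        by (simp add: sum_distrib_right mult.assoc)
      also have "\<dots> = (\<Sum>\<gamma>'\<in>S. LINT x|M. c t \<gamma>' * (L (char_fun \<gamma>') x * cnj (char_fun \<gamma> x)))"
        by (intro Bochner_Integration.integral_sum integrable_mult_right times_char L_int char_fun_polynomial)
      finally show ?thesis by (simp add: l_def fourier_def)
    qed
    \<comment> \<open>The pairing is at most \<open>B\<close> times the L1 norm of
      \<open>g t\<close>, which is at most twice its L_q norm, hence at most
      \<open>2 * \<bar>K\<bar> * B\<close>; \<open>K\<close> may be negative, hence the absolute
      value.\<close>
    have E_le: "cmod (E t) \<le> 2 * \<bar>K\<bar> * B\<^sup>2" for t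
    proof -
      have "Lp_norm M q (g t) \<le> K * N (f t)" unfolding g_def by (rule L_bound[OF f_poly])
      also have "\<dots> \<le> \<bar>K\<bar> * \<bar>N (f t)\<bar>" by (metis abs_ge_self abs_mult)
      also have "\<dots> \<le> \<bar>K\<bar> * B" using N f_poly f_le by (intro mult_left_mono) auto
      finally have Lp_le: "Lp_norm M q (g t) \<le> \<bar>K\<bar> * B" .
      have "cmod (E t) \<le> (LINT x|M. cmod (g t x * cnj (f t x)))"
        unfolding E_def by (rule integral_norm_bound)
      also have "\<dots> \<le> (LINT x|M. B * cmod (g t x))"
      proof (rule integral_mono)
        have "(\<lambda>x. g t x * cnj (f t x)) \<in> borel_measurable M"
          by (rule borel_measurable_times[OF borel_measurable_integrable[OF g_int] continuous_imp_measurable])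
            (intro continuous_intros f_cont)
        then show "integrable M (\<lambda>x. cmod (g t x * cnj (f t x)))"
          by (intro Bochner_Integration.integrable_bound[OF integrable_mult_right[OF g_int[of t], of B]]
              integrable_norm)
            (use f_le B0 in \<open>auto simp: norm_mult mult.commute[of B] intro!: mult_left_mono\<close>)
        show "integrable M (\<lambda>x. B * cmod (g t x))" using g_int[of t] by simp
        show "cmod (g t x * cnj (f t x)) \<le> B * cmod (g t x)" for x
          unfolding norm_mult complex_mod_cnj mult.commute[of B] by (intro mult_left_mono f_le) simp
      qed
      also have "\<dots> \<le> B * (2 * Lp_norm M q (g t))"
        using integral_norm_le_Lp_norm[OF q g_Lq[of t]] B0 by (simp add: mult_left_mono)
      also have "\<dots> \<le> B * (2 * (\<bar>K\<bar> * B))"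
        by (intro mult_left_mono Lp_le B0) simp
      finally show ?thesis by (simp add: power2_eq_square mult_ac)
    qed
    \<comment> \<open>Unimodularity turns the contribution of \<open>mho\<close> into the constant
      \<open>w\<close> for each \<open>\<gamma>\<close>; \<open>t\<close> survives only in products
      of characters.\<close>
    have E_eq: "E t = (\<Sum>\<gamma>\<in>S. w - (\<Sum>\<gamma>'\<in>S. cnj (a \<gamma>) * a \<gamma>' * l \<gamma>' \<gamma> * (char_fun \<gamma>' t * cnj (char_fun \<gamma> t))))" for t
    proof -
      have "E t = (LINT x|M. (\<Sum>\<gamma>\<in>S. cnj (c t \<gamma>) * (g t x * cnj (char_fun \<gamma> x))))"
        unfolding E_def f_def by (simp add: sum_distrib_left mult_ac)
      also have "\<dots> = (\<Sum>\<gamma>\<in>S. LINT x|M. cnj (c t \<gamma>) * (g t x * cnj (char_fun \<gamma> x)))"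
        by (intro Bochner_Integration.integral_sum integrable_mult_right times_char g_int)
      also have "\<dots> = (\<Sum>\<gamma>\<in>S. cnj (c t \<gamma>) * fourier M (g t) \<gamma>)"
        by (simp add: fourier_def)
      also have "\<dots> = (\<Sum>\<gamma>\<in>S. cnj (c t \<gamma>) * (c t \<gamma> * w - (\<Sum>\<gamma>'\<in>S. c t \<gamma>' * l \<gamma>' \<gamma>)))"
      proof (intro sum.cong refl)
        fix \<gamma> assume "\<gamma> \<in> S"
        have "fourier M (g t) \<gamma> = fourier M (mho M \<phi> (f t)) \<gamma> - fourier M (L (f t)) \<gamma>"
          unfolding fourier_def g_def left_diff_distrib
          by (intro Bochner_Integration.integral_diff times_char mho_int L_int f_poly)
        then show "cnj (c t \<gamma>) * fourier M (g t) \<gamma>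
            = cnj (c t \<gamma>) * (c t \<gamma> * w - (\<Sum>\<gamma>'\<in>S. c t \<gamma>' * l \<gamma>' \<gamma>))"
          using \<open>\<gamma> \<in> S\<close> by (simp add: four_mho four_L)
      qed
      also have "\<dots> = (\<Sum>\<gamma>\<in>S. w - (\<Sum>\<gamma>'\<in>S. cnj (a \<gamma>) * a \<gamma>' * l \<gamma>' \<gamma> * (char_fun \<gamma>' t * cnj (char_fun \<gamma> t))))"
      proof (intro sum.cong refl)
        fix \<gamma> assume "\<gamma> \<in> S"
        have "cnj (c t \<gamma>) * (c t \<gamma> * w) = w"
          using complex_norm_square[of "c t \<gamma>"] c_norm[OF \<open>\<gamma> \<in> S\<close>, of t]
          by (simp add: mult.assoc[symmetric] mult.commute[of "cnj _"])
        then show "cnj (c t \<gamma>) * (c t \<gamma> * w - (\<Sum>\<gamma>'\<in>S. c t \<gamma>' * l \<gamma>' \<gamma>))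
            = w - (\<Sum>\<gamma>'\<in>S. cnj (a \<gamma>) * a \<gamma>' * l \<gamma>' \<gamma> * (char_fun \<gamma>' t * cnj (char_fun \<gamma> t)))"
          by (simp add: right_diff_distrib sum_distrib_left) (simp add: c_def mult_ac)
      qed
      finally show ?thesis .
    qed
    let ?D = "\<lambda>\<gamma> \<gamma>' t. cnj (a \<gamma>) * a \<gamma>' * l \<gamma>' \<gamma> * (char_fun \<gamma>' t * cnj (char_fun \<gamma> t))"
    have D_cont: "continuous_on UNIV (?D \<gamma> \<gamma>')" for \<gamma> \<gamma>'
      by (intro continuous_intros continuous_char_fun)
    \<comment> \<open>Orthogonality of characters in \<open>t\<close> leaves the diagonal, where the
      coefficients contribute \<open>a \<gamma> * cnj (a \<gamma>) = 1\<close>.\<close>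
    have D_int: "(LINT t|M. ?D \<gamma> \<gamma>' t) = (if \<gamma>' = \<gamma> then l \<gamma> \<gamma> else 0)" if "\<gamma> \<in> S" for \<gamma> \<gamma>'
    proof -
      have "(LINT t|M. ?D \<gamma> \<gamma>' t) = cnj (a \<gamma>) * a \<gamma>' * l \<gamma>' \<gamma> * fourier M (char_fun \<gamma>') \<gamma>"
        by (simp add: fourier_def)
      also have "\<dots> = (if \<gamma>' = \<gamma> then a \<gamma> * cnj (a \<gamma>) * l \<gamma> \<gamma> else 0)"
        by (simp add: fourier_char_fun mult_ac)
      finally show ?thesis
        using complex_norm_square[of "a \<gamma>"] a[OF that] by simp
    qed
    have E_fun: "E = (\<lambda>t. \<Sum>\<gamma>\<in>S. w - (\<Sum>\<gamma>'\<in>S. ?D \<gamma> \<gamma>' t))" by (rule ext) (rule E_eq)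
    have "(LINT t|M. E t) = (\<Sum>\<gamma>\<in>S. LINT t|M. w - (\<Sum>\<gamma>'\<in>S. ?D \<gamma> \<gamma>' t))"
      unfolding E_fun
      by (intro Bochner_Integration.integral_sum continuous_imp_integrable continuous_on_diff
          continuous_on_sum continuous_on_const D_cont)
    also have "\<dots> = (\<Sum>\<gamma>\<in>S. w - A \<gamma>)"
    proof (intro sum.cong refl)
      fix \<gamma> assume \<gamma>: "\<gamma> \<in> S"
      have "(LINT t|M. w - (\<Sum>\<gamma>'\<in>S. ?D \<gamma> \<gamma>' t)) = (LINT t|M. w) - (LINT t|M. (\<Sum>\<gamma>'\<in>S. ?D \<gamma> \<gamma>' t))"
        by (intro Bochner_Integration.integral_diff continuous_imp_integrable
            continuous_on_sum continuous_on_const D_cont)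
      also have "(LINT t|M. (\<Sum>\<gamma>'\<in>S. ?D \<gamma> \<gamma>' t)) = (\<Sum>\<gamma>'\<in>S. LINT t|M. ?D \<gamma> \<gamma>' t)"
        by (intro Bochner_Integration.integral_sum continuous_imp_integrable D_cont)
      also have "\<dots> = (\<Sum>\<gamma>'\<in>S. if \<gamma>' = \<gamma> then l \<gamma> \<gamma> else 0)"
        by (intro sum.cong refl D_int \<gamma>)
      also have "\<dots> = A \<gamma>" using S \<gamma> by (simp add: A_def l_def)
      finally show "(LINT t|M. w - (\<Sum>\<gamma>'\<in>S. ?D \<gamma> \<gamma>' t)) = w - A \<gamma>" using prob_space by simp
    qed
    finally have "(\<Sum>\<gamma>\<in>S. w - A \<gamma>) = (LINT t|M. E t)" by simp
    moreover have "cmod (LINT t|M. E t) \<le> 2 * \<bar>K\<bar> * B\<^sup>2"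
    proof (rule norm_integral_le[OF _ E_le])
      show "continuous_on UNIV E"
        unfolding E_fun by (intro continuous_on_diff continuous_on_sum continuous_on_const D_cont)
    qed
    ultimately show ?thesis by (simp add: w_def)
  qed
  then show ?thesis by (intro exI[of _ A] exI[of _ "2 * \<bar>K\<bar>"]) blast
qed

lemma not_trivial:
  assumes inf: "infinite (UNIV :: 'a set)"
    and lipschitz: "C-lipschitz_on {0..} \<phi>" and \<phi>0: "\<phi> 0 = 0" and unbounded: "\<not> bounded (\<phi> ` {0..})"
    and q: "1 \<le> q" "q \<le> (2 :: ereal)"
    and N: "\<And>f B. f \<in> polynomials \<Longrightarrow> (\<And>x. cmod (f x) \<le> B) \<Longrightarrow> \<bar>N f\<bar> \<le> B"
  shows "\<not> trivial_into_Lq polynomials N M q (mho M \<phi>)"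
proof
  assume trivial: "trivial_into_Lq polynomials N M q (mho M \<phi>)"
  obtain A :: "'a dual \<Rightarrow> complex" and K where AK: "\<forall>S a B. finite S \<longrightarrow> (\<forall>\<gamma>\<in>S. cmod (a \<gamma>) = 1) \<longrightarrow>
    (\<forall>x. cmod (\<Sum>\<gamma>\<in>S. a \<gamma> * char_fun \<gamma> x) \<le> B) \<longrightarrow>
    cmod (\<Sum>\<gamma>\<in>S. complex_of_real (\<phi> (ln (sqrt (card S)))) - A \<gamma>) \<le> K * B\<^sup>2"
    using multiplier_bound[OF q _ trivial] N by blast
  have bound: "cmod (\<Sum>\<gamma>\<in>S. complex_of_real (\<phi> (ln (sqrt (card S)))) - A \<gamma>) \<le> K * B\<^sup>2"
    if "finite S" "\<And>\<gamma>. \<gamma> \<in> S \<Longrightarrow> cmod (a \<gamma>) = 1"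
      "\<And>x. cmod (\<Sum>\<gamma>\<in>S. a \<gamma> * char_fun \<gamma> x) \<le> B" for S a B
    using AK that by blast
  \<comment> \<open>For a single character the argument of \<open>\<phi>\<close> is
    \<open>ln 1 = 0\<close>, so only the symbol \<open>A\<close> is left.\<close>
  have A_le: "cmod (A \<gamma>) \<le> K" for \<gamma>
    using bound[of "{\<gamma>}" "\<lambda>_. 1" 1] by (simp add: \<phi>0)
  \<comment> \<open>With \<open>B\<^sup>2 = 2 ^ (k + 1)\<close> the estimate contributes
    \<open>2 * K\<close> per element of \<open>S\<close>, and the bound on \<open>A\<close> another
    \<open>K\<close>.\<close>
  have dyadic: "\<bar>\<phi> (real k * (ln 2 / 2))\<bar> \<le> 3 * K" for k
  proof -
    obtain S :: "'a dual set" and a where S: "finite S" "card S = 2 ^ k" "\<And>\<gamma>. \<gamma> \<in> S \<Longrightarrow> cmod (a \<gamma>) = 1"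
      "\<And>x. (cmod (\<Sum>\<gamma>\<in>S. a \<gamma> * char_fun \<gamma> x))\<^sup>2 \<le> 2 ^ (k + 1)"
      using Rudin_Shapiro[OF infinite_dual[OF inf], of k] by metis
    define s where "s = complex_of_real (\<phi> (real k * (ln 2 / 2)))"
    have lnS: "ln (sqrt (card S)) = real k * (ln 2 / 2)"
      using S(2) by (simp add: ln_sqrt ln_realpow)
    have "cmod (\<Sum>\<gamma>\<in>S. s - A \<gamma>) \<le> K * (sqrt (2 ^ (k + 1)))\<^sup>2"
      unfolding s_def lnS[symmetric] by (rule bound) (use S in \<open>auto intro: real_le_rsqrt\<close>)
    moreover have "(\<Sum>\<gamma>\<in>S. s - A \<gamma>) = 2 ^ k * s - (\<Sum>\<gamma>\<in>S. A \<gamma>)"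
      using S(2) by (simp add: sum_subtractf)
    moreover have "cmod (\<Sum>\<gamma>\<in>S. A \<gamma>) \<le> 2 ^ k * K"
      using sum_norm_le[of S A "\<lambda>_. K"] A_le S(2) by simp
    moreover have "cmod (2 ^ k * s) \<le> cmod (2 ^ k * s - (\<Sum>\<gamma>\<in>S. A \<gamma>)) + cmod (\<Sum>\<gamma>\<in>S. A \<gamma>)"
      using norm_triangle_sub[of "2 ^ k * s" "\<Sum>\<gamma>\<in>S. A \<gamma>"] by simp
    ultimately have "cmod (2 ^ k * s) \<le> 2 ^ k * (3 * K)"
      by (simp add: algebra_simps del: norm_mult)
    then have "2 ^ k * cmod s \<le> 2 ^ k * (3 * K)"
      by (simp only: norm_mult norm_power norm_numeral)
    then show ?thesis by (simp add: s_def)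
  qed
  have "\<bar>\<phi> s\<bar> \<le> 3 * K + C" if s: "s \<ge> 0" for s
  proof -
    define d :: real where "d = ln 2 / 2"
    have d: "d > 0" "d \<le> 1" using ln_2_less_1 by (auto simp: d_def)
    \<comment> \<open>\<open>k * d\<close> is the grid point just below \<open>s\<close>; the
      distance is less than \<open>d \<le> 1\<close>, so the Lipschitz condition costs at most
      \<open>C\<close>.\<close>
    define k where "k = nat \<lfloor>s / d\<rfloor>"
    have k: "real k \<le> s / d" "s / d < real k + 1"
      using s d unfolding k_def by (auto simp: of_nat_nat)
    then have k': "real k * d \<le> s" "s < real k * d + d"
      using d by (simp_all add: field_simps)
    have "dist (\<phi> s) (\<phi> (real k * d)) \<le> C * dist s (real k * d)"
      using lipschitz_onD[OF lipschitz] s d by simp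
    also have "\<dots> \<le> C * 1"
      using k' d lipschitz_on_nonneg[OF lipschitz] by (intro mult_left_mono) (auto simp: dist_real_def)
    finally show ?thesis using dyadic[of k] by (simp add: dist_real_def d_def)
  qed
  then have "bounded (\<phi> ` {0..})"
    by (auto simp: bounded_iff intro!: exI[of _ "3 * K + C"])
  then show False using unbounded by simp
qed

end

theorem theorem3p4:
  fixes M :: "'a::{topological_ab_group_add, t2_space} measure"
    and \<phi> :: "real \<Rightarrow> real"
  assumes "compact (UNIV :: 'a set)"
    and "infinite (UNIV :: 'a set)"
    and "normalized_haar M"
    and "essentially_concave \<phi>"
    and "\<not> bounded (\<phi> ` {0..})"
  shows "\<not> trivial_into_Lq polynomials sup_norm M 1 (mho M \<phi>) \<and>
    (\<forall>p q :: ereal. 1 \<le> q \<and> q \<le> 2 \<and> 2 \<le> p \<longrightarrow>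
       \<not> trivial_into_Lq polynomials (Lp_norm M p) M q (mho M \<phi>))"
proof -
  interpret compact_haar_group M
    using assms by unfold_locales
  obtain C where \<phi>: "C-lipschitz_on {0..} \<phi>" "\<phi> 0 = 0"
    using assms(4) by (auto simp: essentially_concave_def)
  \<comment> \<open>The source norm and \<open>q\<close> stay open here, so that one fact serves
    both conjuncts.\<close>
  note not_trivial = not_trivial[OF assms(2) \<phi> assms(5)]
  have meas: "f \<in> borel_measurable M" if "f \<in> polynomials" for f
    using that continuous_trig_sum by (auto simp: polynomials_def intro!: continuous_imp_measurable)
  show ?thesis
    by (intro conjI allI impI not_trivial)
      (auto simp: sup_norm_le_bound intro!: Lp_norm_le_bound meas)
qed

end
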